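(* For $\psi\in\mathcal{H}^\infty$ put $f_\psi(z,w):=(e_{\bar z,\bar w},\psi)$, $z\in\mathbb{C}$, $|w|<1$. Then the differential action of the generators $a,a^+,K_-,K_0,K_+$ of the Jacobi algebra, i.e. the assignment $X\mapsto\mathbb{X}$ of differential operators in $(z,w)$ characterized by $$\mathbb{X}f_\psi(z,w)=(e_{\bar z,\bar w},\boldsymbol{X}\psi)\qquad(\psi\in\mathcal{H}^\infty,\ z\in\mathbb{C},\ |w|<1),$$ where $\boldsymbol{X}$ is the operator on $\mathcal{H}^\infty$ representing $X$, is given by $$\mathbb{a}=\frac{\partial}{\partial z},\qquad \mathbb{a}^+=z+w\frac{\partial}{\partial z},$$ $$\mathbb{K}_-=\frac{\partial}{\partial w},\qquad \mathbb{K}_0=k+\frac12 z\frac{\partial}{\partial z}+w\frac{\partial}{\partial w},$$ $$\mathbb{K}_+=\frac12z^2+2kw+zw\frac{\partial}{\partial z}+w^2\frac{\partial}{\partial w},$$ where $z\in\mathbb{C}$, $|w|<1$.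
   Context: The Jacobi algebra is $\mathfrak{g}^J_1=\mathfrak{h}_1\rtimes\mathfrak{su}(1,1)$, where $\mathfrak{h}_1=\{is1+xa^+-\bar xa: s\in\mathbb{R},x\in\mathbb{C}\}$ is an ideal and $\mathfrak{su}(1,1)=\{2i\theta K_0+yK_+-\bar yK_-:\theta\in\mathbb{R},y\in\mathbb{C}\}$, with commutation relations ($1$ central) $[a,a^+]=1$; $[K_0,K_\pm]=\pm K_\pm$; $[K_-,K_+]=2K_0$; $[a,K_+]=a^+$; $[K_-,a^+]=a$; $[K_+,a^+]=[K_-,a]=0$; $[K_0,a^+]=\frac12a^+$; $[K_0,a]=-\frac12a$. One is given a continuous unitary representation of the Jacobi group $G^J_1=H_1\rtimes \mathrm{SU}(1,1)$ ($H_1$ the 3-dimensional Heisenberg-Weyl group) on a separable complex Hilbert space $\mathcal{H}$. Its derived representation, extended complex linearly, represents $a,a^+,K_0,K_\pm$ by operators (written $a,a^+,\boldsymbol{K}_0,\boldsymbol{K}_\pm$) on the dense space $\mathcal{H}^\infty$ of smooth vectors, satisfying the commutation relations above with $1$ acting as the identity, and with formal adjoints $(a^+)^+=a$, $\boldsymbol{K}_0^+=\boldsymbol{K}_0$, $\boldsymbol{K}_\pm^+=\boldsymbol{K}_\mp$. There is a cyclic vector $e_0\in\mathcal{H}^\infty$ with $ae_0=0$, $\boldsymbol{K}_-e_0=0$, $\boldsymbol{K}_0e_0=ke_0$, where $k>0$, $2k\in\{2,3,\dots\}$. The scalar product $(\cdot,\cdot)$ is antilinear in the first argument and linear in the second.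 Perelomov's coherent state vectors are $e_{z,w}:=e^{za^++w\boldsymbol{K}_+}e_0$ (exponential power series applied to $e_0$), $z\in\mathbb{C}$, $|w|<1$. *)

theory Defs
  imports "HOL-Analysis.Analysis" "HOL-Algebra.Group"
begin

section \<open>Complex Hilbert spaces\<close>

text \<open>The scalar product is antilinear in the first and linear in the second argument.
  Positive definiteness is contained in the last axiom.\<close>

class complex_hilbert = banach +
  fixes scaleC :: "complex \<Rightarrow> 'a \<Rightarrow> 'a" (infixr "*\<^sub>C" 75)
    and cinner :: "'a \<Rightarrow> 'a \<Rightarrow> complex"
  assumes scaleC_add_right: "c *\<^sub>C (x + y) = c *\<^sub>C x + c *\<^sub>C y"
    and scaleC_add_left: "(c + d) *\<^sub>C x = c *\<^sub>C x + d *\<^sub>C x"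
    and scaleC_scaleC: "c *\<^sub>C d *\<^sub>C x = (c * d) *\<^sub>C x"
    and scaleR_scaleC: "r *\<^sub>R x = complex_of_real r *\<^sub>C x"
    and cinner_commute: "cinner x y = cnj (cinner y x)"
    and cinner_add_right: "cinner x (y + z) = cinner x y + cinner x z"
    and cinner_scaleC_right: "cinner x (c *\<^sub>C y) = c * cinner x y"
    and cinner_self: "cinner x x = complex_of_real ((norm x)\<^sup>2)"

instantiation complex :: complex_hilbert
begin

definition scaleC_complex :: "complex \<Rightarrow> complex \<Rightarrow> complex"
  where "scaleC_complex c x = c * x"

definition cinner_complex :: "complex \<Rightarrow> complex \<Rightarrow> complex"
  where "cinner_complex x y = cnj x * y"

instance
proof
  show "cinner x x = complex_of_real ((norm x)\<^sup>2)" for x :: complex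
    by (metis cinner_complex_def complex_norm_square mult.commute of_real_power)
qed (simp_all add: scaleC_complex_def cinner_complex_def algebra_simps scaleR_conv_of_real)

end

definition unitary_op :: "('h::complex_hilbert \<Rightarrow> 'h) \<Rightarrow> bool" where
  "unitary_op U \<longleftrightarrow>
     (\<forall>x y. U (x + y) = U x + U y) \<and> (\<forall>c x. U (c *\<^sub>C x) = c *\<^sub>C U x) \<and>
     (\<forall>x y. cinner (U x) (U y) = cinner x y) \<and> surj U"

section \<open>The Jacobi group\<close>

text \<open>
  A quadruple \<open>(\<alpha>, s, p, q)\<close> stands for the product of the element \<open>(\<alpha>, s)\<close> of the
  Heisenberg group and the matrix with rows \<open>(p, q)\<close> and \<open>(cnj q, cnj p)\<close> of \<open>SU(1,1)\<close>.
  The Heisenberg group has the law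
  \<open>(\<alpha>, s) (\<beta>, t) = (\<alpha> + \<beta>, s + t + Im (\<alpha> cnj \<beta>))\<close>, where \<open>(\<alpha>, s)\<close> is
  \<open>exp (\<alpha> a\<^sup>+ - cnj \<alpha> a + i s 1)\<close>; the cocycle is forced by \<open>[a, a\<^sup>+] = 1\<close>.
  \<open>SU(1,1)\<close> acts on it by \<open>\<alpha> \<mapsto> p \<alpha> + q cnj \<alpha>\<close>, which integrates the action of
  \<open>su(1,1)\<close> on the ideal \<open>h\<^sub>1\<close> by commutators.
\<close>

type_synonym jacobi = "complex \<times> real \<times> complex \<times> complex"

definition su11_act :: "complex \<Rightarrow> complex \<Rightarrow> complex \<Rightarrow> complex" where
  "su11_act p q \<alpha> = p * \<alpha> + q * cnj \<alpha>"

fun jacobi_mult :: "jacobi \<Rightarrow> jacobi \<Rightarrow> jacobi" where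
  "jacobi_mult (\<alpha>, s, p, q) (\<beta>, t, p', q') =
     (\<alpha> + su11_act p q \<beta>,
      s + t + Im (\<alpha> * cnj (su11_act p q \<beta>)),
      p * p' + q * cnj q',
      p * q' + q * cnj p')"

definition jacobi_group :: "jacobi monoid" where
  "jacobi_group =
     \<lparr> carrier = {(\<alpha>, s, p, q). (cmod p)\<^sup>2 - (cmod q)\<^sup>2 = 1},
       mult = jacobi_mult, one = (0, 0, 1, 0) \<rparr>"

lemma su11_norm_mult:
  "(cmod (p * p' + q * cnj q'))\<^sup>2 - (cmod (p * q' + q * cnj p'))\<^sup>2 =
     ((cmod p)\<^sup>2 - (cmod q)\<^sup>2) * ((cmod p')\<^sup>2 - (cmod q')\<^sup>2)"
  unfolding cmod_power2 by (simp add: power2_eq_square algebra_simps)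

lemma su11_act_symplectic:
  "Im (su11_act p q \<alpha> * cnj (su11_act p q \<beta>)) = ((cmod p)\<^sup>2 - (cmod q)\<^sup>2) * Im (\<alpha> * cnj \<beta>)"
  unfolding su11_act_def cmod_power2 by (simp add: power2_eq_square algebra_simps)

lemma group_jacobi_group: "group jacobi_group"
proof (rule groupI)
  show "\<one>\<^bsub>jacobi_group\<^esub> \<in> carrier jacobi_group"
    by (simp add: jacobi_group_def)
next
  fix g h assume "g \<in> carrier jacobi_group" "h \<in> carrier jacobi_group"
  then show "g \<otimes>\<^bsub>jacobi_group\<^esub> h \<in> carrier jacobi_group"
    by (cases g; cases h) (simp add: jacobi_group_def su11_norm_mult)
next
  fix g assume "g \<in> carrier jacobi_group"
  then show "\<one>\<^bsub>jacobi_group\<^esub> \<otimes>\<^bsub>jacobi_group\<^esub> g = g"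
    by (cases g) (simp add: jacobi_group_def su11_act_def)
next
  fix g h l
  assume g: "g \<in> carrier jacobi_group" and "h \<in> carrier jacobi_group"
    and "l \<in> carrier jacobi_group"
  obtain \<alpha> s p q where [simp]: "g = (\<alpha>, s, p, q)" by (cases g)
  obtain \<beta> t p' q' where [simp]: "h = (\<beta>, t, p', q')" by (cases h)
  obtain \<gamma> u p'' q'' where [simp]: "l = (\<gamma>, u, p'', q'')" by (cases l)
  have n: "(cmod p)\<^sup>2 - (cmod q)\<^sup>2 = 1" using g by (simp add: jacobi_group_def)
  have act: "su11_act (p * p' + q * cnj q') (p * q' + q * cnj p') \<gamma> =
      su11_act p q (su11_act p' q' \<gamma>)"
    by (simp add: su11_act_def algebra_simps)
  have add: "su11_act p q (x + y) = su11_act p q x + su11_act p q y" for x y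
    by (simp add: su11_act_def algebra_simps)
  have sym: "Im (su11_act p q x * cnj (su11_act p q y)) = Im (x * cnj y)" for x y
    using n by (simp only: su11_act_symplectic)
  have "Im ((\<alpha> + su11_act p q \<beta>) * cnj (su11_act p q (su11_act p' q' \<gamma>))) =
      Im (\<alpha> * cnj (su11_act p q (su11_act p' q' \<gamma>))) + Im (\<beta> * cnj (su11_act p' q' \<gamma>))"
    by (simp only: distrib_right plus_complex.sel sym)
  moreover have "Im (\<alpha> * cnj (su11_act p q \<beta> + su11_act p q (su11_act p' q' \<gamma>))) =
      Im (\<alpha> * cnj (su11_act p q \<beta>)) + Im (\<alpha> * cnj (su11_act p q (su11_act p' q' \<gamma>)))"
    by (simp only: complex_cnj_add distrib_left plus_complex.sel)
  ultimately show "g \<otimes>\<^bsub>jacobi_group\<^esub> h \<otimes>\<^bsub>jacobi_group\<^esub> l =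
      g \<otimes>\<^bsub>jacobi_group\<^esub> (h \<otimes>\<^bsub>jacobi_group\<^esub> l)"
    by (simp add: jacobi_group_def act add del: times_complex.sel)
       (simp add: algebra_simps del: times_complex.sel)
next
  fix g assume g: "g \<in> carrier jacobi_group"
  obtain \<alpha> s p q where [simp]: "g = (\<alpha>, s, p, q)" by (cases g)
  have n: "(cmod p)\<^sup>2 - (cmod q)\<^sup>2 = 1" using g by (simp add: jacobi_group_def)
  have n': "cnj p * p - q * cnj q = 1"
    using n unfolding cmod_power2 complex_eq_iff by (simp add: power2_eq_square algebra_simps)
  let ?h = "(- su11_act (cnj p) (- q) \<alpha>, - s, cnj p, - q)"
  show "\<exists>h\<in>carrier jacobi_group. h \<otimes>\<^bsub>jacobi_group\<^esub> g = \<one>\<^bsub>jacobi_group\<^esub>"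
  proof (rule bexI)
    show "?h \<otimes>\<^bsub>jacobi_group\<^esub> g = \<one>\<^bsub>jacobi_group\<^esub>"
      using n' by (simp add: jacobi_group_def)
    show "?h \<in> carrier jacobi_group" using n by (simp add: jacobi_group_def)
  qed
qed

section \<open>The Jacobi algebra\<close>

text \<open>The tangent vector at the identity which is the element
  \<open>i s 1 + x a\<^sup>+ - cnj x a + 2 i \<theta> K\<^sub>0 + y K\<^sub>+ - cnj y K\<^sub>-\<close> of the real Jacobi algebra; here
  \<open>2 i \<theta> K\<^sub>0 + y K\<^sub>+ - cnj y K\<^sub>-\<close> is the matrix with rows \<open>(i \<theta>, y)\<close> and \<open>(cnj y, - i \<theta>)\<close>.\<close>

definition jacobi_alg :: "real \<Rightarrow> complex \<Rightarrow> real \<Rightarrow> complex \<Rightarrow> jacobi" where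
  "jacobi_alg s x \<theta> y = (x, s, \<i> * complex_of_real \<theta>, y)"

definition one_param_subgroup :: "jacobi \<Rightarrow> (real \<Rightarrow> jacobi) \<Rightarrow> bool" where
  "one_param_subgroup X \<gamma> \<longleftrightarrow>
     (\<forall>t. \<gamma> t \<in> carrier jacobi_group) \<and>
     (\<forall>t u. \<gamma> (t + u) = \<gamma> t \<otimes>\<^bsub>jacobi_group\<^esub> \<gamma> u) \<and>
     (\<gamma> has_vector_derivative X) (at 0)"

text \<open>\<open>jacobi_exp X t\<close> is \<open>exp (t X)\<close>.\<close>

definition jacobi_exp :: "jacobi \<Rightarrow> real \<Rightarrow> jacobi" where
  "jacobi_exp X = (THE \<gamma>. one_param_subgroup X \<gamma>)"

datatype jacobi_gen = Gen_a | Gen_a_plus | Gen_K_minus | Gen_K_zero | Gen_K_plus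

text \<open>The generators in the complexified algebra, written as \<open>X + i Y\<close> with \<open>X\<close>, \<open>Y\<close> in the
  real one. For instance
  \<open>a = - 1/2 (a\<^sup>+ - a) + i (- i/2 a\<^sup>+ - i/2 a)\<close> and \<open>K\<^sub>0 = i (- i K\<^sub>0)\<close>.\<close>

fun gen_re :: "jacobi_gen \<Rightarrow> jacobi" where
  "gen_re Gen_a = jacobi_alg 0 (- 1 / 2) 0 0"
| "gen_re Gen_a_plus = jacobi_alg 0 (1 / 2) 0 0"
| "gen_re Gen_K_minus = jacobi_alg 0 0 0 (- 1 / 2)"
| "gen_re Gen_K_zero = jacobi_alg 0 0 0 0"
| "gen_re Gen_K_plus = jacobi_alg 0 0 0 (1 / 2)"

fun gen_im :: "jacobi_gen \<Rightarrow> jacobi" where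
  "gen_im Gen_a = jacobi_alg 0 (- \<i> / 2) 0 0"
| "gen_im Gen_a_plus = jacobi_alg 0 (- \<i> / 2) 0 0"
| "gen_im Gen_K_minus = jacobi_alg 0 0 0 (- \<i> / 2)"
| "gen_im Gen_K_zero = jacobi_alg 0 0 (- 1 / 2) 0"
| "gen_im Gen_K_plus = jacobi_alg 0 0 0 (- \<i> / 2)"

section \<open>Unitary representations, smooth vectors and the derived representation\<close>

definition cont_unitary_rep :: "(jacobi \<Rightarrow> 'h::complex_hilbert \<Rightarrow> 'h) \<Rightarrow> bool" where
  "cont_unitary_rep \<pi> \<longleftrightarrow>
     (\<forall>g\<in>carrier jacobi_group. unitary_op (\<pi> g)) \<and>
     (\<forall>g\<in>carrier jacobi_group. \<forall>h\<in>carrier jacobi_group.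
        \<pi> (g \<otimes>\<^bsub>jacobi_group\<^esub> h) = \<pi> g \<circ> \<pi> h) \<and>
     (\<forall>\<psi>. continuous_on (carrier jacobi_group) (\<lambda>g. \<pi> g \<psi>))"

text \<open>For a finite-dimensional domain the following is the usual class \<open>C\<^sup>n\<close>.\<close>

primrec Cn_map :: "nat \<Rightarrow> ('a::real_normed_vector \<Rightarrow> 'b::real_normed_vector) \<Rightarrow> bool" where
  "Cn_map 0 f \<longleftrightarrow> continuous_on UNIV f"
| "Cn_map (Suc n) f \<longleftrightarrow>
     (\<exists>f'. (\<forall>x. (f has_derivative f' x) (at x)) \<and> (\<forall>v. Cn_map n (\<lambda>x. f' x v)))"

text \<open>A surjective local diffeomorphism from a vector space onto the group: a map on the
  group is smooth iff its composition with \<open>jacobi_cover\<close> is.\<close>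

definition jacobi_cover :: "complex \<times> real \<times> real \<times> complex \<Rightarrow> jacobi" where
  "jacobi_cover = (\<lambda>(\<alpha>, s, \<theta>, q). (\<alpha>, s, cis \<theta> * complex_of_real (sqrt (1 + (cmod q)\<^sup>2)), q))"

definition smooth_vectors :: "(jacobi \<Rightarrow> 'h::complex_hilbert \<Rightarrow> 'h) \<Rightarrow> 'h set" where
  "smooth_vectors \<pi> = {\<psi>. \<forall>n. Cn_map n (\<lambda>x. \<pi> (jacobi_cover x) \<psi>)}"

definition drep :: "(jacobi \<Rightarrow> 'h::complex_hilbert \<Rightarrow> 'h) \<Rightarrow> jacobi \<Rightarrow> 'h \<Rightarrow> 'h" where
  "drep \<pi> X \<psi> = vector_derivative (\<lambda>t. \<pi> (jacobi_exp X t) \<psi>) (at 0)"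

definition gen_op :: "(jacobi \<Rightarrow> 'h::complex_hilbert \<Rightarrow> 'h) \<Rightarrow> jacobi_gen \<Rightarrow> 'h \<Rightarrow> 'h" where
  "gen_op \<pi> X \<psi> = drep \<pi> (gen_re X) \<psi> + \<i> *\<^sub>C drep \<pi> (gen_im X) \<psi>"

locale jacobi_lowest_weight_rep =
  fixes \<pi> :: "jacobi \<Rightarrow> 'h::complex_hilbert \<Rightarrow> 'h" and e0 :: 'h and k :: real
  assumes separable: "\<exists>S::'h set. countable S \<and> closure S = UNIV"
    and rep: "cont_unitary_rep \<pi>"
    \<comment> \<open>the derived representation on the dense space of smooth vectors\<close>
    and smooth_dense: "closure (smooth_vectors \<pi>) = UNIV"
    and smooth_invariant: "\<psi> \<in> smooth_vectors \<pi> \<Longrightarrow> gen_op \<pi> X \<psi> \<in> smooth_vectors \<pi>"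
    and one_identity: "\<psi> \<in> smooth_vectors \<pi> \<Longrightarrow> drep \<pi> (jacobi_alg s 0 0 0) \<psi> = (\<i> * of_real s) *\<^sub>C \<psi>"
    and comm_a_a_plus: "\<psi> \<in> smooth_vectors \<pi> \<Longrightarrow>
      gen_op \<pi> Gen_a (gen_op \<pi> Gen_a_plus \<psi>) - gen_op \<pi> Gen_a_plus (gen_op \<pi> Gen_a \<psi>) = \<psi>"
    and comm_K_zero_K_plus: "\<psi> \<in> smooth_vectors \<pi> \<Longrightarrow>
      gen_op \<pi> Gen_K_zero (gen_op \<pi> Gen_K_plus \<psi>) - gen_op \<pi> Gen_K_plus (gen_op \<pi> Gen_K_zero \<psi>)
        = gen_op \<pi> Gen_K_plus \<psi>"
    and comm_K_zero_K_minus: "\<psi> \<in> smooth_vectors \<pi> \<Longrightarrow>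
      gen_op \<pi> Gen_K_zero (gen_op \<pi> Gen_K_minus \<psi>) - gen_op \<pi> Gen_K_minus (gen_op \<pi> Gen_K_zero \<psi>)
        = - gen_op \<pi> Gen_K_minus \<psi>"
    and comm_K_minus_K_plus: "\<psi> \<in> smooth_vectors \<pi> \<Longrightarrow>
      gen_op \<pi> Gen_K_minus (gen_op \<pi> Gen_K_plus \<psi>) - gen_op \<pi> Gen_K_plus (gen_op \<pi> Gen_K_minus \<psi>)
        = 2 *\<^sub>C gen_op \<pi> Gen_K_zero \<psi>"
    and comm_a_K_plus: "\<psi> \<in> smooth_vectors \<pi> \<Longrightarrow>
      gen_op \<pi> Gen_a (gen_op \<pi> Gen_K_plus \<psi>) - gen_op \<pi> Gen_K_plus (gen_op \<pi> Gen_a \<psi>)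
        = gen_op \<pi> Gen_a_plus \<psi>"
    and comm_K_minus_a_plus: "\<psi> \<in> smooth_vectors \<pi> \<Longrightarrow>
      gen_op \<pi> Gen_K_minus (gen_op \<pi> Gen_a_plus \<psi>) - gen_op \<pi> Gen_a_plus (gen_op \<pi> Gen_K_minus \<psi>)
        = gen_op \<pi> Gen_a \<psi>"
    and comm_K_plus_a_plus: "\<psi> \<in> smooth_vectors \<pi> \<Longrightarrow>
      gen_op \<pi> Gen_K_plus (gen_op \<pi> Gen_a_plus \<psi>) - gen_op \<pi> Gen_a_plus (gen_op \<pi> Gen_K_plus \<psi>) = 0"
    and comm_K_minus_a: "\<psi> \<in> smooth_vectors \<pi> \<Longrightarrow>
      gen_op \<pi> Gen_K_minus (gen_op \<pi> Gen_a \<psi>) - gen_op \<pi> Gen_a (gen_op \<pi> Gen_K_minus \<psi>) = 0"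
    and comm_K_zero_a_plus: "\<psi> \<in> smooth_vectors \<pi> \<Longrightarrow>
      gen_op \<pi> Gen_K_zero (gen_op \<pi> Gen_a_plus \<psi>) - gen_op \<pi> Gen_a_plus (gen_op \<pi> Gen_K_zero \<psi>)
        = (1 / 2) *\<^sub>C gen_op \<pi> Gen_a_plus \<psi>"
    and comm_K_zero_a: "\<psi> \<in> smooth_vectors \<pi> \<Longrightarrow>
      gen_op \<pi> Gen_K_zero (gen_op \<pi> Gen_a \<psi>) - gen_op \<pi> Gen_a (gen_op \<pi> Gen_K_zero \<psi>)
        = (- 1 / 2) *\<^sub>C gen_op \<pi> Gen_a \<psi>"
    and adjoint_a_plus: "\<phi> \<in> smooth_vectors \<pi> \<Longrightarrow> \<psi> \<in> smooth_vectors \<pi> \<Longrightarrow>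
      cinner (gen_op \<pi> Gen_a_plus \<phi>) \<psi> = cinner \<phi> (gen_op \<pi> Gen_a \<psi>)"
    and adjoint_K_zero: "\<phi> \<in> smooth_vectors \<pi> \<Longrightarrow> \<psi> \<in> smooth_vectors \<pi> \<Longrightarrow>
      cinner (gen_op \<pi> Gen_K_zero \<phi>) \<psi> = cinner \<phi> (gen_op \<pi> Gen_K_zero \<psi>)"
    and adjoint_K_plus: "\<phi> \<in> smooth_vectors \<pi> \<Longrightarrow> \<psi> \<in> smooth_vectors \<pi> \<Longrightarrow>
      cinner (gen_op \<pi> Gen_K_plus \<phi>) \<psi> = cinner \<phi> (gen_op \<pi> Gen_K_minus \<psi>)"
    \<comment> \<open>the cyclic lowest weight vector; the real span below is the complex span of the orbit\<close>
    and e0_smooth: "e0 \<in> smooth_vectors \<pi>"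
    and e0_nonzero: "e0 \<noteq> 0"
    and e0_cyclic: "closure (span {c *\<^sub>C \<pi> g e0 | c g. g \<in> carrier jacobi_group}) = UNIV"
    and a_e0: "gen_op \<pi> Gen_a e0 = 0"
    and K_minus_e0: "gen_op \<pi> Gen_K_minus e0 = 0"
    and K_zero_e0: "gen_op \<pi> Gen_K_zero e0 = of_real k *\<^sub>C e0"
    and k_pos: "k > 0"
    and two_k: "\<exists>n::nat. n \<ge> 2 \<and> 2 * k = real n"

section \<open>Coherent states\<close>

text \<open>For \<open>cmod w < 1\<close> the exponential series converges as a consequence of the commutation
  relations, so the junk value of \<open>suminf\<close> plays no role there.\<close>

definition coherent_vec ::
  "(jacobi \<Rightarrow> 'h::complex_hilbert \<Rightarrow> 'h) \<Rightarrow> 'h \<Rightarrow> complex \<Rightarrow> complex \<Rightarrow> 'h" where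
  "coherent_vec \<pi> e0 z w =
     (\<Sum>n. (1 / fact n) *\<^sub>R
        ((\<lambda>v. z *\<^sub>C gen_op \<pi> Gen_a_plus v + w *\<^sub>C gen_op \<pi> Gen_K_plus v) ^^ n) e0)"

definition coherent_fun ::
  "(jacobi \<Rightarrow> 'h::complex_hilbert \<Rightarrow> 'h) \<Rightarrow> 'h \<Rightarrow> 'h \<Rightarrow> complex \<Rightarrow> complex \<Rightarrow> complex" where
  "coherent_fun \<pi> e0 \<psi> z w = cinner (coherent_vec \<pi> e0 (cnj z) (cnj w)) \<psi>"

section \<open>Holomorphic differential operators in two variables\<close>

text \<open>Holomorphic functions on the product of the plane with the open unit disk.\<close>

definition holo_CxD :: "(complex \<Rightarrow> complex \<Rightarrow> complex) \<Rightarrow> bool" where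
  "holo_CxD f \<longleftrightarrow>
     (\<forall>z w. cmod w < 1 \<longrightarrow>
        (\<exists>A B. ((\<lambda>(u, v). f u v) has_derivative (\<lambda>(h, l). A * h + B * l)) (at (z, w))))"

definition dz :: "(complex \<Rightarrow> complex \<Rightarrow> complex) \<Rightarrow> complex \<Rightarrow> complex \<Rightarrow> complex" where
  "dz f z w = deriv (\<lambda>u. f u w) z"

definition dw :: "(complex \<Rightarrow> complex \<Rightarrow> complex) \<Rightarrow> complex \<Rightarrow> complex \<Rightarrow> complex" where
  "dw f z w = deriv (\<lambda>v. f z v) w"

text \<open>Differential operators of finite order with holomorphic coefficients; only their action on
  functions holomorphic on the domain, evaluated at points of the domain, is meaningful.\<close>

definition diff_op ::
  "((complex \<Rightarrow> complex \<Rightarrow> complex) \<Rightarrow> complex \<Rightarrow> complex \<Rightarrow> complex) \<Rightarrow> bool" where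
  "diff_op D \<longleftrightarrow>
     (\<exists>N c. (\<forall>i\<le>N. \<forall>j\<le>N. holo_CxD (c i j)) \<and>
        (\<forall>f. holo_CxD f \<longrightarrow> (\<forall>z w. cmod w < 1 \<longrightarrow>
           D f z w = (\<Sum>i\<le>N::nat. \<Sum>j\<le>N. c i j z w * (dz ^^ i) ((dw ^^ j) f) z w))))"

end

theory Submission
  imports Defs "HOL-Complex_Analysis.Complex_Analysis"
begin

text \<open>
  Write \<open>e\<^bsub>z,w\<^esub> = \<Sum>n. y\<^sub>n\<close> with \<open>y\<^sub>n = (z a\<^sup>+ + w K\<^sub>+)\<^sup>n e\<^sub>0 / n!\<close>. Moving one factor to the other side of
  the scalar product gives \<open>(n + 1) (y\<^sub>n\<^sub>+\<^sub>1, \<psi>) = cnj z (y\<^sub>n, a \<psi>) + cnj w (y\<^sub>n, K\<^sub>- \<psi>)\<close>. With the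
  commutation relations, induction on \<open>n\<close> then expresses \<open>(y\<^sub>n, a\<^sup>+ \<psi>)\<close>, \<open>(y\<^sub>n, K\<^sub>0 \<psi>)\<close> and
  \<open>(y\<^sub>n, K\<^sub>+ \<psi>)\<close> through the products of lower terms with \<open>\<psi>\<close>, \<open>a \<psi>\<close> and \<open>K\<^sub>- \<psi>\<close>. Applied to
  \<open>\<psi> = y\<^sub>n\<close> itself, the same identities bound \<open>\<parallel>y\<^sub>n\<parallel>\<close> by a sequence with ratio tending to
  some \<open>\<rho> < 1\<close>, locally uniformly in \<open>z\<close> and \<open>\<bar>w\<bar> < 1\<close>. Hence the series may be differentiated
  term by term, \<open>\<partial>\<^sub>z f\<^sub>\<psi>\<close> is the function of \<open>a \<psi>\<close>, \<open>\<partial>\<^sub>w f\<^sub>\<psi>\<close> that of \<open>K\<^sub>- \<psi>\<close>, and the formulas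
  for the other generators follow by summation.

  Uniqueness: the functions \<open>f\<^sub>\<psi>\<close> contain the constants and are stable under the five operators,
  which suffices to obtain all polynomials, and polynomials determine the coefficients of a
  differential operator.
\<close>

section \<open>Complex Hilbert spaces\<close>

lemma cinner_add_left: "cinner (x + y) z = cinner x z + cinner y (z :: 'h::complex_hilbert)"
  by (metis cinner_add_right cinner_commute complex_cnj_add)

lemma cinner_scaleC_left: "cinner (c *\<^sub>C x) (y :: 'h::complex_hilbert) = cnj c * cinner x y"
  by (metis cinner_commute cinner_scaleC_right complex_cnj_mult)

lemma cinner_zero_right [simp]: "cinner x (0 :: 'h::complex_hilbert) = 0"
  using cinner_add_right[of x 0 0] by simp

lemma cinner_zero_left [simp]: "cinner 0 (x :: 'h::complex_hilbert) = 0"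
  using cinner_add_left[of 0 0 x] by simp

lemma cinner_diff_right: "cinner x (y - z) = cinner x y - cinner x (z :: 'h::complex_hilbert)"
  using cinner_add_right[of x "y - z" z] by (simp add: algebra_simps)

lemma cinner_diff_left: "cinner (x - y) z = cinner x z - cinner y (z :: 'h::complex_hilbert)"
  using cinner_add_left[of "x - y" y z] by (simp add: algebra_simps)

lemma cinner_scaleR_left: "cinner (r *\<^sub>R x) (y :: 'h::complex_hilbert) = r * cinner x y"
  by (simp add: scaleR_scaleC cinner_scaleC_left)

lemma scaleC_one [simp]: "1 *\<^sub>C x = (x :: 'h::complex_hilbert)"
  using scaleR_scaleC[of 1 x] by simp

lemma norm_scaleC: "norm (c *\<^sub>C x) = cmod c * norm (x :: 'h::complex_hilbert)"
proof -
  have "complex_of_real ((norm (c *\<^sub>C x))\<^sup>2) = of_real ((cmod c * norm x)\<^sup>2)"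
    by (simp only: cinner_self[symmetric] cinner_scaleC_left cinner_scaleC_right)
      (simp add: cinner_self complex_norm_square[symmetric] power_mult_distrib mult_ac)
  then show ?thesis
    by (simp only: of_real_eq_iff) (simp add: power2_eq_iff_nonneg)
qed

text \<open>Cancels one factor of \<open>(norm x)\<^sup>2\<close>; this finishes estimates where
  Cauchy-Schwarz has left a factor \<open>norm x\<close> on the right.\<close>

lemma norm_le_of_cinner_self_le:
  assumes "cmod (cinner x x) \<le> c * norm (x :: 'a::complex_hilbert)" "0 \<le> c"
  shows "norm x \<le> c"
  using assms by (cases "x = 0") (auto simp: cinner_self norm_mult power2_eq_square)

lemma bounded_linear_scaleC: "bounded_linear (\<lambda>x :: 'h::complex_hilbert. c *\<^sub>C x)"
  by (rule bounded_linear_intro[where K = "cmod c"])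
    (simp_all add: scaleC_add_right scaleR_scaleC scaleC_scaleC norm_scaleC mult.commute)

lemma cinner_Cauchy_Schwarz: "cmod (cinner x y) \<le> norm x * norm (y :: 'h::complex_hilbert)"
proof (cases "x = 0")
  case False
  \<comment> \<open>\<open>c *\<^sub>C x\<close> is the orthogonal projection of \<open>y\<close>
    onto the line of \<open>x\<close>, so Pythagoras applies to \<open>d\<close> and
    \<open>c *\<^sub>C x\<close>.\<close>
  define c where "c = cinner x y / of_real ((norm x)\<^sup>2)"
  define d where "d = y - c *\<^sub>C x"
  have y: "y = d + c *\<^sub>C x"
    by (simp add: d_def)
  have xd: "cinner x d = 0"
    using False by (simp add: d_def cinner_diff_right cinner_scaleC_right cinner_self c_def)
  then have dx: "cinner d x = 0"
    by (metis cinner_commute complex_cnj_zero)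
  have "complex_of_real ((norm y)\<^sup>2) = of_real ((norm d)\<^sup>2 + (norm (c *\<^sub>C x))\<^sup>2)"
    unfolding of_real_add cinner_self[symmetric]
    by (subst (1 2) y)
      (simp add: cinner_add_left cinner_add_right cinner_scaleC_left cinner_scaleC_right xd dx)
  then have "(norm (c *\<^sub>C x))\<^sup>2 \<le> (norm y)\<^sup>2"
    by (simp only: of_real_eq_iff) simp
  then have "cmod c * norm x \<le> norm y"
    by (simp add: norm_scaleC power2_le_iff_abs_le)
  then show ?thesis
    using False by (simp add: c_def norm_divide norm_mult field_simps power2_eq_square)
qed simp

lemma bounded_linear_cinner_left: "bounded_linear (\<lambda>x. cinner x (y :: 'h::complex_hilbert))"
  by (rule bounded_linear_intro[where K = "norm y"])
    (simp_all add: cinner_add_left cinner_scaleR_left scaleR_conv_of_real cinner_Cauchy_Schwarz)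

text \<open>Approximating \<open>x - y\<close> from \<open>S\<close>, continuity of the product
  gives \<open>cinner (x - y) (x - y) = 0\<close>.\<close>

lemma eq_of_cinner_dense_eq:
  fixes x y :: "'h::complex_hilbert"
  assumes "closure S = UNIV" and eq: "\<And>\<psi>. \<psi> \<in> S \<Longrightarrow> cinner x \<psi> = cinner y \<psi>"
  shows "x = y"
proof -
  have "x - y \<in> closure S"
    using assms(1) by simp
  then obtain s where s: "\<And>n. s n \<in> S" "s \<longlonglongrightarrow> x - y"
    by (auto simp: closure_sequential)
  have *: "cinner (s n) (x - y) = 0" for n
    using eq[OF s(1)[of n]] cinner_commute[of "s n" "x - y"] by (simp add: cinner_diff_left)
  have "(\<lambda>n. cinner (s n) (x - y)) \<longlonglongrightarrow> cinner (x - y) (x - y)"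
    by (rule bounded_linear.tendsto[OF bounded_linear_cinner_left s(2)])
  then have "cinner (x - y) (x - y) = 0"
    by (simp add: * LIMSEQ_const_iff)
  then show ?thesis
    by (simp add: cinner_self)
qed

section \<open>Smooth vectors\<close>

lemma Cn_map_add: "Cn_map n f \<Longrightarrow> Cn_map n g \<Longrightarrow> Cn_map n (\<lambda>x. f x + g x)"
proof (induction n arbitrary: f g)
  case 0
  then show ?case by (simp add: continuous_on_add)
next
  case (Suc n)
  then obtain f' g' where "\<And>x. (f has_derivative f' x) (at x)" "\<And>v. Cn_map n (\<lambda>x. f' x v)"
    "\<And>x. (g has_derivative g' x) (at x)" "\<And>v. Cn_map n (\<lambda>x. g' x v)"
    by auto
  with Suc.IH show ?case
    by (auto intro!: exI[of _ "\<lambda>x v. f' x v + g' x v"] has_derivative_add)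
qed

lemma Cn_map_bounded_linear: "bounded_linear T \<Longrightarrow> Cn_map n f \<Longrightarrow> Cn_map n (\<lambda>x. T (f x))"
proof (induction n arbitrary: f)
  case 0
  then show ?case by (simp add: bounded_linear.continuous_on)
next
  case (Suc n)
  then obtain f' where "\<And>x. (f has_derivative f' x) (at x)" "\<And>v. Cn_map n (\<lambda>x. f' x v)"
    by auto
  with Suc.IH Suc.prems(1) show ?case
    by (auto intro!: exI[of _ "\<lambda>x v. T (f' x v)"]
        bounded_linear.has_derivative[OF Suc.prems(1)])
qed

lemma jacobi_cover_in_carrier: "jacobi_cover x \<in> carrier jacobi_group"
  by (cases x) (simp add: jacobi_cover_def jacobi_group_def norm_mult power_mult_distrib)

context jacobi_lowest_weight_rep
begin

abbreviation "S \<equiv> smooth_vectors \<pi>"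
abbreviation "A \<equiv> gen_op \<pi> Gen_a"
abbreviation "P \<equiv> gen_op \<pi> Gen_a_plus"
abbreviation "Km \<equiv> gen_op \<pi> Gen_K_minus"
abbreviation "K0 \<equiv> gen_op \<pi> Gen_K_zero"
abbreviation "Kp \<equiv> gen_op \<pi> Gen_K_plus"

lemma unitary_cover: "unitary_op (\<pi> (jacobi_cover x))"
  using rep jacobi_cover_in_carrier unfolding cont_unitary_rep_def by blast

lemma smooth_add: "\<phi> \<in> S \<Longrightarrow> \<psi> \<in> S \<Longrightarrow> \<phi> + \<psi> \<in> S"
  using unitary_cover by (simp add: smooth_vectors_def unitary_op_def Cn_map_add)

lemma smooth_scaleC: "\<psi> \<in> S \<Longrightarrow> c *\<^sub>C \<psi> \<in> S"
  using unitary_cover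
  by (simp add: smooth_vectors_def unitary_op_def Cn_map_bounded_linear[OF bounded_linear_scaleC])

lemmas smooth_intros = smooth_add smooth_scaleC smooth_invariant e0_smooth

lemma adjoint_a: "\<phi> \<in> S \<Longrightarrow> \<psi> \<in> S \<Longrightarrow> cinner (A \<phi>) \<psi> = cinner \<phi> (P \<psi>)"
  by (metis adjoint_a_plus cinner_commute)

lemma adjoint_K_minus: "\<phi> \<in> S \<Longrightarrow> \<psi> \<in> S \<Longrightarrow> cinner (Km \<phi>) \<psi> = cinner \<phi> (Kp \<psi>)"
  by (metis adjoint_K_plus cinner_commute)

text \<open>\<open>gen_op\<close> is built from \<open>vector_derivative\<close>, so homogeneity is
  not read off its definition. By adjointness both sides have equal products with all smooth
  vectors, and these are dense.\<close>

lemma a_plus_scaleC: "\<phi> \<in> S \<Longrightarrow> P (c *\<^sub>C \<phi>) = c *\<^sub>C P \<phi>"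
  by (rule eq_of_cinner_dense_eq[OF smooth_dense])
    (simp add: adjoint_a_plus smooth_scaleC cinner_scaleC_left)

lemma K_plus_scaleC: "\<phi> \<in> S \<Longrightarrow> Kp (c *\<^sub>C \<phi>) = c *\<^sub>C Kp \<phi>"
  by (rule eq_of_cinner_dense_eq[OF smooth_dense])
    (simp add: adjoint_K_plus smooth_scaleC cinner_scaleC_left)

section \<open>Homogeneous terms of the coherent vectors\<close>

text \<open>The factors \<open>1 / of_nat (Suc n)\<close> accumulate to \<open>1 / fact n\<close>,
  so these are the summands of the exponential series.\<close>

primrec coh_term :: "complex \<Rightarrow> complex \<Rightarrow> nat \<Rightarrow> 'h" where
  "coh_term z w 0 = e0"
| "coh_term z w (Suc n) =
     (1 / of_nat (Suc n)) *\<^sub>C (z *\<^sub>C P (coh_term z w n) + w *\<^sub>C Kp (coh_term z w n))"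

lemma coh_term_smooth: "coh_term z w n \<in> S"
  by (induction n) (auto intro!: smooth_intros)

lemma coh_term_eq:
  "((\<lambda>v. z *\<^sub>C P v + w *\<^sub>C Kp v) ^^ n) e0 = fact n *\<^sub>C coh_term z w n"
proof (induction n)
  case (Suc n)
  have "((\<lambda>v. z *\<^sub>C P v + w *\<^sub>C Kp v) ^^ Suc n) e0 =
      z *\<^sub>C P (fact n *\<^sub>C coh_term z w n) + w *\<^sub>C Kp (fact n *\<^sub>C coh_term z w n)"
    by (simp add: Suc.IH)
  also have "\<dots> = fact n *\<^sub>C (z *\<^sub>C P (coh_term z w n) + w *\<^sub>C Kp (coh_term z w n))"
    by (simp add: a_plus_scaleC K_plus_scaleC coh_term_smooth scaleC_add_right scaleC_scaleC
        mult.commute)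
  also have "\<dots> = fact (Suc n) *\<^sub>C coh_term z w (Suc n)"
    by (simp add: scaleC_scaleC del: of_nat_Suc)
  finally show ?case .
qed simp

lemma coherent_vec_eq: "coherent_vec \<pi> e0 z w = (\<Sum>n. coh_term z w n)"
proof -
  have "(1 / fact n) *\<^sub>R (fact n *\<^sub>C coh_term z w n) = coh_term z w n" for n
    by (simp add: scaleR_scaleC scaleC_scaleC)
  then show ?thesis
    by (simp add: coherent_vec_def coh_term_eq)
qed

text \<open>The conjugates compensate the antilinear first slot: for smooth \<open>\<psi>\<close>
  this is a homogeneous polynomial of degree \<open>n\<close> in \<open>z\<close> and
  \<open>w\<close>.\<close>

definition q :: "nat \<Rightarrow> 'h \<Rightarrow> complex \<Rightarrow> complex \<Rightarrow> complex" where
  "q n \<psi> z w = cinner (coh_term (cnj z) (cnj w) n) \<psi>"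

lemma q_diff: "q n (\<phi> - \<psi>) z w = q n \<phi> z w - q n \<psi> z w"
  by (simp add: q_def cinner_diff_right)

lemma q_scaleC: "q n (c *\<^sub>C \<psi>) z w = c * q n \<psi> z w"
  by (simp add: q_def cinner_scaleC_right)

text \<open>Adjointness turns the outermost factor of \<open>coh_term\<close> into lowering
  operators on \<open>\<psi>\<close>. This drives the inductions on the degree below.\<close>

lemma q_Suc: "\<psi> \<in> S \<Longrightarrow> of_nat (Suc n) * q (Suc n) \<psi> z w = z * q n (A \<psi>) z w + w * q n (Km \<psi>) z w"
  by (simp add: q_def cinner_scaleC_left cinner_add_left adjoint_a_plus adjoint_K_plus
      coh_term_smooth del: of_nat_Suc)

lemma q_0: "q 0 \<psi> z w = cinner e0 \<psi>"
  by (simp add: q_def)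

section \<open>Lowest weight conditions and commutation relations inside the products
  \<open>q\<close>\<close>

lemma q_0_a_plus: "\<psi> \<in> S \<Longrightarrow> q 0 (P \<psi>) z w = 0"
  using adjoint_a[OF e0_smooth, of \<psi>] by (simp add: q_0 a_e0)

lemma q_0_K_plus: "\<psi> \<in> S \<Longrightarrow> q 0 (Kp \<psi>) z w = 0"
  using adjoint_K_minus[OF e0_smooth, of \<psi>] by (simp add: q_0 K_minus_e0)

lemma q_0_K_zero: "\<psi> \<in> S \<Longrightarrow> q 0 (K0 \<psi>) z w = of_real k * q 0 \<psi> z w"
  using adjoint_K_zero[OF e0_smooth, of \<psi>] by (simp add: q_0 K_zero_e0 cinner_scaleC_left)

lemma q_a_a_plus: "\<psi> \<in> S \<Longrightarrow> q n (A (P \<psi>)) z w = q n (P (A \<psi>)) z w + q n \<psi> z w"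
  using q_diff[of n "A (P \<psi>)" "P (A \<psi>)" z w] by (simp add: comm_a_a_plus)

lemma q_K_minus_a_plus: "\<psi> \<in> S \<Longrightarrow> q n (Km (P \<psi>)) z w = q n (P (Km \<psi>)) z w + q n (A \<psi>) z w"
  using q_diff[of n "Km (P \<psi>)" "P (Km \<psi>)" z w] by (simp add: comm_K_minus_a_plus)

lemma q_a_K_zero:
  "\<psi> \<in> S \<Longrightarrow> q n (A (K0 \<psi>)) z w = q n (K0 (A \<psi>)) z w + 1 / 2 * q n (A \<psi>) z w"
  using q_diff[of n "K0 (A \<psi>)" "A (K0 \<psi>)" z w] by (simp add: comm_K_zero_a q_scaleC field_simps)

lemma q_K_minus_K_zero:
  "\<psi> \<in> S \<Longrightarrow> q n (Km (K0 \<psi>)) z w = q n (K0 (Km \<psi>)) z w + q n (Km \<psi>) z w"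
  using q_diff[of n "K0 (Km \<psi>)" "Km (K0 \<psi>)" z w] q_diff[of n 0 "Km \<psi>" z w]
  by (simp add: comm_K_zero_K_minus) (simp add: q_def algebra_simps)

lemma q_a_K_plus: "\<psi> \<in> S \<Longrightarrow> q n (A (Kp \<psi>)) z w = q n (Kp (A \<psi>)) z w + q n (P \<psi>) z w"
  using q_diff[of n "A (Kp \<psi>)" "Kp (A \<psi>)" z w] by (simp add: comm_a_K_plus)

lemma q_K_minus_K_plus:
  "\<psi> \<in> S \<Longrightarrow> q n (Km (Kp \<psi>)) z w = q n (Kp (Km \<psi>)) z w + 2 * q n (K0 \<psi>) z w"
  using q_diff[of n "Km (Kp \<psi>)" "Kp (Km \<psi>)" z w] by (simp add: comm_K_minus_K_plus q_scaleC)

lemma q_a_K_minus: "\<psi> \<in> S \<Longrightarrow> q n (A (Km \<psi>)) z w = q n (Km (A \<psi>)) z w"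
  using comm_K_minus_a[of \<psi>] by simp

text \<open>The degree \<open>n + 1\<close> part of the formula for \<open>a\<^sup>+\<close>, with
  \<open>q n (A \<psi>)\<close> in the place of the z-derivative of \<open>q (Suc n) \<psi>\<close>.
  After \<open>q_Suc\<close> and the commutators, the induction hypothesis is used at
  \<open>A \<psi>\<close> and \<open>Km \<psi>\<close>.\<close>

lemma q_a_plus:
  "\<psi> \<in> S \<Longrightarrow> q (Suc n) (P \<psi>) z w = z * q n \<psi> z w + w * q n (A \<psi>) z w"
proof (induction n arbitrary: \<psi>)
  case 0
  then show ?case
    using q_Suc[of "P \<psi>" 0 z w]
    by (simp add: smooth_invariant q_a_a_plus q_K_minus_a_plus q_0_a_plus)
next
  case (Suc n)
  have "of_nat (Suc (Suc n)) * q (Suc (Suc n)) (P \<psi>) z w =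
      z * q (Suc n) \<psi> z w + w * q (Suc n) (A \<psi>) z w +
      z * (z * q n (A \<psi>) z w + w * q n (Km \<psi>) z w) +
      w * (z * q n (A (A \<psi>)) z w + w * q n (Km (A \<psi>)) z w)"
    using Suc.prems
    by (simp add: q_Suc smooth_invariant q_a_a_plus q_K_minus_a_plus Suc.IH
        q_a_K_minus algebra_simps del: of_nat_Suc)
  \<comment> \<open>By \<open>q_Suc\<close> read backwards, the bracketed sums are
    \<open>n + 1\<close> copies of \<open>q (Suc n) \<psi>\<close> and
    \<open>q (Suc n) (A \<psi>)\<close>; the commutator terms supply one more copy of each.\<close>
  also have "\<dots> = of_nat (Suc (Suc n)) * (z * q (Suc n) \<psi> z w + w * q (Suc n) (A \<psi>) z w)"
    by (simp only: q_Suc[symmetric] Suc.prems smooth_invariant) (simp add: algebra_simps)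
  finally show ?case
    by (simp only: mult_cancel_left of_nat_eq_0_iff) simp
qed

text \<open>Same scheme as \<open>q_a_plus\<close>: moving \<open>A\<close> and \<open>Km\<close>
  past \<open>K0\<close> returns 1/2 and 1 times themselves, which raises the factor
  \<open>n + 1\<close> left by \<open>q_Suc\<close> to \<open>n + 2\<close>.\<close>

lemma q_K_zero:
  "\<psi> \<in> S \<Longrightarrow> q (Suc n) (K0 \<psi>) z w =
     of_real k * q (Suc n) \<psi> z w + 1 / 2 * z * q n (A \<psi>) z w + w * q n (Km \<psi>) z w"
proof (induction n arbitrary: \<psi>)
  case 0
  then show ?case
    using q_Suc[of "K0 \<psi>" 0 z w] q_Suc[of \<psi> 0 z w]
    by (simp add: smooth_invariant q_a_K_zero q_K_minus_K_zero q_0_K_zero algebra_simps)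
next
  case (Suc n)
  have "of_nat (Suc (Suc n)) * q (Suc (Suc n)) (K0 \<psi>) z w =
      of_real k * (z * q (Suc n) (A \<psi>) z w + w * q (Suc n) (Km \<psi>) z w) +
      1 / 2 * z * (z * q n (A (A \<psi>)) z w + w * q n (Km (A \<psi>)) z w) +
      w * (z * q n (A (Km \<psi>)) z w + w * q n (Km (Km \<psi>)) z w) +
      1 / 2 * z * q (Suc n) (A \<psi>) z w + w * q (Suc n) (Km \<psi>) z w"
    using Suc.prems
    by (simp add: q_Suc smooth_invariant q_a_K_zero q_K_minus_K_zero Suc.IH
        q_a_K_minus algebra_simps del: of_nat_Suc)
  also have "\<dots> = of_real k * (of_nat (Suc (Suc n)) * q (Suc (Suc n)) \<psi> z w) +
      1 / 2 * z * (of_nat (Suc n) * q (Suc n) (A \<psi>) z w) +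
      w * (of_nat (Suc n) * q (Suc n) (Km \<psi>) z w) +
      1 / 2 * z * q (Suc n) (A \<psi>) z w + w * q (Suc n) (Km \<psi>) z w"
    by (simp only: q_Suc Suc.prems smooth_invariant)
  also have "\<dots> = of_nat (Suc (Suc n)) * (of_real k * q (Suc (Suc n)) \<psi> z w +
      1 / 2 * z * q (Suc n) (A \<psi>) z w + w * q (Suc n) (Km \<psi>) z w)"
    by (simp add: field_simps)
  finally show ?case
    by (simp only: mult_cancel_left of_nat_eq_0_iff) simp
qed

text \<open>The \<open>z\<^sup>2\<close> term of the general identity reaches back two degrees, so
  degree 1 is a separate starting value; what survives is the commutator \<open>2 K0\<close> acting
  at \<open>e0\<close>.\<close>

lemma q_1_K_plus: "\<psi> \<in> S \<Longrightarrow> q 1 (Kp \<psi>) z w = 2 * of_real k * w * q 0 \<psi> z w"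
  using q_Suc[of "Kp \<psi>" 0 z w]
  by (simp add: smooth_invariant q_a_K_plus q_K_minus_K_plus q_0_K_zero q_0_a_plus q_0_K_plus)

text \<open>The commutators of \<open>A\<close> and \<open>Km\<close> with \<open>Kp\<close> are
  \<open>P\<close> and \<open>2 K0\<close>, so \<open>q_a_plus\<close> and \<open>q_K_zero\<close>
  enter besides the induction hypothesis.\<close>

lemma q_K_plus:
  "\<psi> \<in> S \<Longrightarrow> q (Suc (Suc n)) (Kp \<psi>) z w =
     2 * of_real k * w * q (Suc n) \<psi> z w + 1 / 2 * z\<^sup>2 * q n \<psi> z w +
     z * w * q n (A \<psi>) z w + w\<^sup>2 * q n (Km \<psi>) z w"
proof (induction n arbitrary: \<psi>)
  case 0
  have "2 * q (Suc (Suc 0)) (Kp \<psi>) z w =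
     z * q 1 (Kp (A \<psi>)) z w + z * q 1 (P \<psi>) z w + w * q 1 (Kp (Km \<psi>)) z w + 2 * w * q 1 (K0 \<psi>) z w"
    using 0 q_Suc[of "Kp \<psi>" 1 z w]
    by (simp add: smooth_invariant q_a_K_plus q_K_minus_K_plus algebra_simps)
  also have "\<dots> = 2 * of_real k * w * q 1 \<psi> z w + 2 * of_real k * w * (z * q 0 (A \<psi>) z w + w * q 0 (Km \<psi>) z w) +
      z\<^sup>2 * q 0 \<psi> z w + 2 * z * w * q 0 (A \<psi>) z w + 2 * w\<^sup>2 * q 0 (Km \<psi>) z w"
    using 0 q_a_plus[of \<psi> 0] q_K_zero[of \<psi> 0]
    by (simp add: smooth_invariant q_1_K_plus[unfolded One_nat_def] algebra_simps power2_eq_square)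
  \<comment> \<open>\<open>q_Suc\<close> recombines the bracket into \<open>q 1 \<psi>\<close>; one
    half of the coefficient \<open>4 k w\<close> comes from \<open>q_1_K_plus\<close>, the other
    from the weight in \<open>K0\<close>.\<close>
  also have "\<dots> = 4 * of_real k * w * q 1 \<psi> z w +
      z\<^sup>2 * q 0 \<psi> z w + 2 * z * w * q 0 (A \<psi>) z w + 2 * w\<^sup>2 * q 0 (Km \<psi>) z w"
    using q_Suc[OF 0, of 0 z w] by simp
  finally show ?case by (simp add: field_simps)
next
  case (Suc n)
  have "of_nat (Suc (Suc (Suc n))) * q (Suc (Suc (Suc n))) (Kp \<psi>) z w =
      2 * of_real k * w * (z * q (Suc n) (A \<psi>) z w + w * q (Suc n) (Km \<psi>) z w) +
      1 / 2 * z\<^sup>2 * (z * q n (A \<psi>) z w + w * q n (Km \<psi>) z w) +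
      z * w * (z * q n (A (A \<psi>)) z w + w * q n (Km (A \<psi>)) z w) +
      w\<^sup>2 * (z * q n (A (Km \<psi>)) z w + w * q n (Km (Km \<psi>)) z w) +
      z * (z * q (Suc n) \<psi> z w + w * q (Suc n) (A \<psi>) z w) +
      2 * w * (of_real k * q (Suc (Suc n)) \<psi> z w +
        1 / 2 * z * q (Suc n) (A \<psi>) z w + w * q (Suc n) (Km \<psi>) z w)"
    using Suc.prems
    by (simp add: q_Suc smooth_invariant q_a_K_plus q_K_minus_K_plus Suc.IH q_a_plus q_K_zero
        q_a_K_minus algebra_simps power2_eq_square del: of_nat_Suc)
  also have "\<dots> = 2 * of_real k * w * (of_nat (Suc (Suc n)) * q (Suc (Suc n)) \<psi> z w) +
      1 / 2 * z\<^sup>2 * (of_nat (Suc n) * q (Suc n) \<psi> z w) +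
      z * w * (of_nat (Suc n) * q (Suc n) (A \<psi>) z w) +
      w\<^sup>2 * (of_nat (Suc n) * q (Suc n) (Km \<psi>) z w) +
      z * (z * q (Suc n) \<psi> z w + w * q (Suc n) (A \<psi>) z w) +
      2 * w * (of_real k * q (Suc (Suc n)) \<psi> z w +
        1 / 2 * z * q (Suc n) (A \<psi>) z w + w * q (Suc n) (Km \<psi>) z w)"
    by (simp only: q_Suc Suc.prems smooth_invariant)
  also have "\<dots> = of_nat (Suc (Suc (Suc n))) * (2 * of_real k * w * q (Suc (Suc n)) \<psi> z w +
      1 / 2 * z\<^sup>2 * q (Suc n) \<psi> z w +
      z * w * q (Suc n) (A \<psi>) z w + w\<^sup>2 * q (Suc n) (Km \<psi>) z w)"
    by (simp add: field_simps power2_eq_square)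
  finally show ?case
    by (simp only: mult_cancel_left of_nat_eq_0_iff) simp
qed

end

section \<open>Convergence\<close>

text \<open>The square root appears because squared norms will be compared. For
  \<open>\<rho> \<ge> 0\<close> the ratios tend to \<open>\<rho>\<close>; \<open>D\<close> absorbs
  the contributions that stay bounded in \<open>n\<close>.\<close>

primrec majorant :: "real \<Rightarrow> real \<Rightarrow> nat \<Rightarrow> real" where
  "majorant \<rho> D 0 = 1"
| "majorant \<rho> D (Suc n) = sqrt (\<rho>\<^sup>2 + D / Suc n) * majorant \<rho> D n"

lemma majorant_nonneg: "D \<ge> 0 \<Longrightarrow> majorant \<rho> D n \<ge> 0"
  by (induction n) auto

text \<open>The ratios tend to \<open>\<rho>\<close>, hence are eventually below any
  \<open>c\<close> strictly between \<open>\<rho>\<close> and 1.\<close>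

lemma summable_majorant:
  assumes "0 \<le> \<rho>" "\<rho> < 1" "D \<ge> 0"
  shows "summable (majorant \<rho> D)"
proof -
  obtain c where c: "\<rho> < c" "c < 1"
    using assms dense by blast
  have "(\<lambda>n. D / real (Suc n)) \<longlonglongrightarrow> 0"
    by (rule LIMSEQ_Suc) (rule lim_const_over_n)
  then have "(\<lambda>n. sqrt (\<rho>\<^sup>2 + D / real (Suc n))) \<longlonglongrightarrow> sqrt (\<rho>\<^sup>2 + 0)"
    by (intro tendsto_intros)
  then have "\<forall>\<^sub>F n in sequentially. sqrt (\<rho>\<^sup>2 + D / real (Suc n)) < c"
    using assms c by (auto dest: order_tendstoD(2))
  then obtain N where N: "\<And>n. n \<ge> N \<Longrightarrow> sqrt (\<rho>\<^sup>2 + D / real (Suc n)) < c"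
    by (auto simp: eventually_sequentially)
  show ?thesis
  proof (rule summable_ratio_test[where c = c and N = N])
    show "norm (majorant \<rho> D (Suc n)) \<le> c * norm (majorant \<rho> D n)" if "n \<ge> N" for n
      using N[OF that] assms(3)
      by (simp add: abs_mult mult_right_mono del: of_nat_Suc)
  qed (use c in auto)
qed

section \<open>Norm estimates for the homogeneous terms\<close>

context jacobi_lowest_weight_rep
begin

text \<open>Lets the identities for \<open>q\<close> be used when \<open>\<psi>\<close> is itself
  built from a \<open>coh_term\<close>.\<close>

lemma cinner_coh_term: "cinner (coh_term z w n) \<psi> = q n \<psi> (cnj z) (cnj w)"
  by (simp add: q_def)

text \<open>Testing \<open>\<eta> = A (coh_term z w (Suc n))\<close> against itself moves
  \<open>a\<close> over as \<open>a\<^sup>+\<close>, where \<open>q_a_plus\<close> lowers the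
  degree; Cauchy-Schwarz then leaves a factor \<open>norm \<eta>\<close> to cancel.\<close>

lemma norm_a_coh_term:
  "norm (A (coh_term z w (Suc n))) \<le>
     cmod z * norm (coh_term z w n) + cmod w * norm (P (coh_term z w n))"
proof (rule norm_le_of_cinner_self_le)
  define \<eta> where "\<eta> = A (coh_term z w (Suc n))"
  have \<eta>: "\<eta> \<in> S"
    unfolding \<eta>_def by (intro smooth_invariant coh_term_smooth)
  have "cinner \<eta> \<eta> = cinner (coh_term z w (Suc n)) (P \<eta>)"
    by (subst (1) \<eta>_def) (rule adjoint_a[OF coh_term_smooth \<eta>])
  also have "\<dots> = cnj z * cinner (coh_term z w n) \<eta> + cnj w * cinner (coh_term z w n) (A \<eta>)"
    by (simp only: cinner_coh_term q_a_plus[OF \<eta>])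
  also have "cinner (coh_term z w n) (A \<eta>) = cinner (P (coh_term z w n)) \<eta>"
    by (rule adjoint_a_plus[OF coh_term_smooth \<eta>, symmetric])
  finally have "cmod (cinner \<eta> \<eta>) \<le>
      cmod z * cmod (cinner (coh_term z w n) \<eta>) + cmod w * cmod (cinner (P (coh_term z w n)) \<eta>)"
    by (simp only:) (rule order_trans[OF norm_triangle_ineq], simp add: norm_mult)
  also have "\<dots> \<le> cmod z * (norm (coh_term z w n) * norm \<eta>) +
      cmod w * (norm (P (coh_term z w n)) * norm \<eta>)"
    by (intro add_mono mult_left_mono cinner_Cauchy_Schwarz) auto
  finally show "cmod (cinner \<eta> \<eta>) \<le>
      (cmod z * norm (coh_term z w n) + cmod w * norm (P (coh_term z w n))) * norm \<eta>"
    by (simp add: algebra_simps)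
qed simp

text \<open>The commutator \<open>[a, a\<^sup>+] = 1\<close> produces the term
  \<open>(norm \<phi>)\<^sup>2\<close>; bounds on \<open>P\<close> reduce to bounds on
  \<open>A\<close>.\<close>

lemma norm_a_plus: "\<phi> \<in> S \<Longrightarrow> (norm (P \<phi>))\<^sup>2 = (norm \<phi>)\<^sup>2 + (norm (A \<phi>))\<^sup>2"
proof -
  assume \<phi>: "\<phi> \<in> S"
  have "cinner (P \<phi>) (P \<phi>) = cinner \<phi> (A (P \<phi>))"
    by (rule adjoint_a_plus) (intro smooth_intros \<phi>)+
  also have "A (P \<phi>) = \<phi> + P (A \<phi>)"
    using comm_a_a_plus[OF \<phi>] by (simp add: algebra_simps)
  also have "cinner \<phi> \<dots> = cinner \<phi> \<phi> + cinner (A \<phi>) (A \<phi>)"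
    by (simp add: cinner_add_right adjoint_a \<phi> smooth_invariant)
  finally show ?thesis
    unfolding cinner_self by (simp only: of_real_add[symmetric] of_real_eq_iff)
qed

lemma norm_a_plus_coh_term_0: "norm (P (coh_term z w 0)) = norm e0"
  using norm_a_plus[OF e0_smooth] by (simp add: a_e0 power2_eq_iff_nonneg)

lemma norm_a_plus_coh_term:
  "norm (P (coh_term z w (Suc n))) \<le> norm (coh_term z w (Suc n)) +
     cmod z * norm (coh_term z w n) + cmod w * norm (P (coh_term z w n))"
proof -
  let ?y = "coh_term z w (Suc n)"
  have "(norm (P ?y))\<^sup>2 \<le> (norm ?y + norm (A ?y))\<^sup>2"
    unfolding norm_a_plus[OF coh_term_smooth] by (simp add: power2_sum)
  then have "norm (P ?y) \<le> norm ?y + norm (A ?y)"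
    by (rule power2_le_imp_le) simp
  then show ?thesis
    using norm_a_coh_term[of z w n] by linarith
qed

lemma cinner_coh_term_Suc:
  "of_nat (Suc n) * cinner (coh_term z w (Suc n)) (coh_term z w (Suc n)) =
     z * cinner (coh_term z w (Suc n)) (P (coh_term z w n)) +
     w * cinner (coh_term z w (Suc n)) (Kp (coh_term z w n))"
  \<comment> \<open>Unfolding the second slot alone keeps the full degree in the first, where
    \<open>q_a_plus\<close> and \<open>q_K_plus\<close> apply.\<close>
  by (subst (2) coh_term.simps)
    (simp add: cinner_scaleC_right cinner_add_right del: of_nat_Suc coh_term.simps)

text \<open>\<open>q_a_plus\<close> and \<open>q_K_plus\<close> evaluate the products of
  \<open>cinner_coh_term_Suc\<close>. The only coefficient growing with \<open>n\<close> is
  \<open>n * (cmod w)\<^sup>2\<close>, against \<open>Suc n\<close> on the left; this is where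
  \<open>cmod w < 1\<close> will give convergence.\<close>

lemma norm_coh_term_Suc:
  "Suc n * (norm (coh_term z w (Suc n)))\<^sup>2 \<le>
     ((cmod z)\<^sup>2 + 2 * k * (cmod w)\<^sup>2 + n * (cmod w)\<^sup>2) * (norm (coh_term z w n))\<^sup>2 +
     cmod z * cmod w * (norm (P (coh_term z w n)) * norm (coh_term z w n)) +
     1 / 2 * cmod w * (cmod z)\<^sup>2 * (norm (coh_term z w (n - 1)) * norm (coh_term z w n))"
    (is "_ \<le> ?rhs")
proof -
  let ?y = "coh_term z w"
  define \<phi> where "\<phi> = coh_term z w n"
  have \<phi>: "\<phi> \<in> S"
    unfolding \<phi>_def by (rule coh_term_smooth)
  \<comment> \<open>For \<open>n = 0\<close> truncated subtraction would give
    \<open>cinner e0 e0\<close>, whereas \<open>q_1_K_plus\<close> has no \<open>z\<^sup>2\<close>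
    term; hence the value 0.\<close>
  define X where "X = (if n = 0 then 0 else cinner (?y (n - 1)) \<phi>)"
  have X: "cmod X \<le> norm (?y (n - 1)) * norm \<phi>"
    using cinner_Cauchy_Schwarz[of "?y (n - 1)" \<phi>] by (simp add: X_def)
  have PP: "cinner (?y (Suc n)) (P \<phi>) = cnj z * cinner \<phi> \<phi> + cnj w * cinner (P \<phi>) \<phi>"
    unfolding cinner_coh_term q_a_plus[OF \<phi>] unfolding cinner_coh_term[symmetric]
    by (simp add: adjoint_a_plus \<phi> \<phi>_def[symmetric])
  have KK: "cinner (?y (Suc n)) (Kp \<phi>) =
      cnj w * (2 * of_real k + of_nat n) * cinner \<phi> \<phi> + 1 / 2 * (cnj z)\<^sup>2 * X"
  proof (cases n)
    case 0
    then show ?thesis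
      using q_1_K_plus[OF \<phi>, of "cnj z" "cnj w"] by (simp add: X_def \<phi>_def q_def)
  next
    case (Suc m)
    have "cinner (?y (Suc n)) (Kp \<phi>) = 2 * of_real k * cnj w * cinner (?y n) \<phi> +
       1 / 2 * (cnj z)\<^sup>2 * cinner (?y m) \<phi> +
       cnj w * (cnj z * cinner (?y m) (A \<phi>) + cnj w * cinner (?y m) (Km \<phi>))"
      unfolding cinner_coh_term Suc q_K_plus[OF \<phi>] by (simp add: algebra_simps power2_eq_square)
    \<comment> \<open>\<open>q_Suc\<close> backwards: the two lowering terms add up to
      \<open>n\<close> times the product in degree \<open>n\<close>.\<close>
    also have "cnj z * cinner (?y m) (A \<phi>) + cnj w * cinner (?y m) (Km \<phi>) = of_nat n * cinner (?y n) \<phi>"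
      unfolding cinner_coh_term Suc q_Suc[OF \<phi>] ..
    finally show ?thesis
      by (simp add: X_def \<phi>_def Suc algebra_simps del: of_nat_Suc coh_term.simps)
  qed
  have sq: "(complex_of_real (cmod c))\<^sup>2 = c * cnj c" for c
    by (metis complex_norm_square of_real_power)
  have "of_nat (Suc n) * cinner (?y (Suc n)) (?y (Suc n)) =
      of_real (((cmod z)\<^sup>2 + (2 * k + n) * (cmod w)\<^sup>2) * (norm \<phi>)\<^sup>2) +
      (z * cnj w * cinner (P \<phi>) \<phi> + 1 / 2 * w * (cnj z)\<^sup>2 * X)"
    unfolding cinner_coh_term_Suc \<phi>_def[symmetric] PP KK
    by (simp add: cinner_self sq algebra_simps)
  then have "cmod (of_nat (Suc n) * cinner (?y (Suc n)) (?y (Suc n))) \<le>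
      cmod (of_real (((cmod z)\<^sup>2 + (2 * k + n) * (cmod w)\<^sup>2) * (norm \<phi>)\<^sup>2)) +
      (cmod (z * cnj w * cinner (P \<phi>) \<phi>) + cmod (1 / 2 * w * (cnj z)\<^sup>2 * X))"
    by (simp only:) (rule order_trans[OF norm_triangle_ineq add_left_mono[OF norm_triangle_ineq]])
  also have "cmod (of_real (((cmod z)\<^sup>2 + (2 * k + n) * (cmod w)\<^sup>2) * (norm \<phi>)\<^sup>2)) =
      ((cmod z)\<^sup>2 + (2 * k + n) * (cmod w)\<^sup>2) * (norm \<phi>)\<^sup>2"
    unfolding norm_of_real using k_pos by (intro abs_of_nonneg) auto
  also have "cmod (z * cnj w * cinner (P \<phi>) \<phi>) \<le> cmod z * cmod w * (norm (P \<phi>) * norm \<phi>)"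
    by (simp add: norm_mult mult_left_mono cinner_Cauchy_Schwarz)
  also have "cmod (1 / 2 * w * (cnj z)\<^sup>2 * X) \<le>
      1 / 2 * cmod w * (cmod z)\<^sup>2 * (norm (?y (n - 1)) * norm \<phi>)"
    using X by (simp add: norm_mult norm_power mult_left_mono)
  also have "cmod (of_nat (Suc n) * cinner (?y (Suc n)) (?y (Suc n))) =
      Suc n * (norm (?y (Suc n)))\<^sup>2"
    unfolding norm_mult cinner_self norm_of_real norm_of_nat by simp
  finally show ?thesis
    by (simp add: \<phi>_def algebra_simps del: of_nat_Suc coh_term.simps)
qed

text \<open>The bounds on \<open>coh_term\<close> and on its image under \<open>P\<close> are
  coupled, so one induction carries both, with a single majorant that depends on \<open>z\<close>
  and \<open>w\<close> only through \<open>R\<close> and \<open>r\<close>.\<close>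

lemma coh_term_bound:
  assumes "0 < r" "r < 1" "0 \<le> R"
  obtains M where "summable M"
    "\<And>z w n. cmod z \<le> R \<Longrightarrow> cmod w \<le> r \<Longrightarrow> norm (coh_term z w n) \<le> M n"
proof -
  obtain \<rho> where \<rho>: "r < \<rho>" "\<rho> < 1"
    using assms dense by blast
  \<comment> \<open>The solution of
    \<open>\<beta> = 1 + R / \<rho> + \<beta> * (r / \<rho>)\<close>, so that the bound on
    \<open>P\<close> reproduces itself in the induction step.\<close>
  define \<beta> where "\<beta> = (1 + R / \<rho>) / (1 - r / \<rho>)"
  have r\<rho>: "r / \<rho> < 1" "\<rho> > 0"
    using \<rho> assms by (auto simp: field_simps)
  then have \<beta>: "1 + R / \<rho> + \<beta> * (r / \<rho>) = \<beta>"
    by (simp add: \<beta>_def divide_simps) (simp add: algebra_simps)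
  have "1 - r / \<rho> \<le> 1" "0 < 1 - r / \<rho>" "1 \<le> 1 + R / \<rho>"
    using r\<rho> assms by auto
  then have \<beta>1: "1 \<le> \<beta>"
    unfolding \<beta>_def by (subst le_divide_eq) auto
  \<comment> \<open>Collects the coefficients in \<open>norm_coh_term_Suc\<close> other than
    \<open>n * r\<^sup>2\<close>, once the inductive bounds are inserted.\<close>
  define D where "D = R\<^sup>2 + 2 * k * r\<^sup>2 + R * r * \<beta> + 1 / 2 * r * R\<^sup>2 * (1 / \<rho>)"
  have D: "D \<ge> 0"
    using assms \<beta>1 r\<rho> k_pos by (simp add: D_def)
  define T where "T = majorant \<rho> D"
  have T0: "T n \<ge> 0" for n
    unfolding T_def by (rule majorant_nonneg[OF D])
  have TS: "(T (Suc n))\<^sup>2 = (\<rho>\<^sup>2 + D / Suc n) * (T n)\<^sup>2" for n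
    using D by (simp add: T_def power_mult_distrib)
  have T_le: "\<rho> * T n \<le> T (Suc n)" for n
    by (rule power2_le_imp_le) (use T0 D in \<open>auto simp: TS power_mult_distrib intro!: mult_right_mono\<close>)
  define C where "C = norm e0"
  have C: "C \<ge> 0"
    by (simp add: C_def)
  \<comment> \<open>The third bound carries along the preceding term; at \<open>n = 0\<close> the
    index \<open>n - 1\<close> is again 0 and \<open>\<rho> < 1\<close> suffices.\<close>
  have main: "norm (coh_term z w n) \<le> C * T n \<and> norm (P (coh_term z w n)) \<le> \<beta> * (C * T n) \<and>
      \<rho> * norm (coh_term z w (n - 1)) \<le> C * T n"
    if zR: "cmod z \<le> R" and wr: "cmod w \<le> r" for z w n
  proof (induction n)
    case 0
    have "T 0 = 1"
      by (simp add: T_def)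
    moreover have "\<rho> * C \<le> 1 * C" "1 * C \<le> \<beta> * C"
      using \<rho> \<beta>1 C by (intro mult_right_mono; simp)+
    ultimately show ?case
      using norm_a_plus_coh_term_0[of z w] by (simp add: C_def)
  next
    case (Suc n)
    let ?y = "coh_term z w"
    define t where "t = C * T n"
    have t: "t \<ge> 0"
      using C T0 by (simp add: t_def)
    have y: "norm (?y n) \<le> t" and Py: "norm (P (?y n)) \<le> \<beta> * t"
      and y': "norm (?y (n - 1)) \<le> 1 / \<rho> * t"
      using Suc r\<rho> by (auto simp: t_def field_simps)
    have "Suc n * (norm (?y (Suc n)))\<^sup>2 \<le>
        (R\<^sup>2 + 2 * k * r\<^sup>2 + n * r\<^sup>2) * t\<^sup>2 + R * r * ((\<beta> * t) * t) +
        1 / 2 * r * R\<^sup>2 * ((1 / \<rho> * t) * t)"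
      using zR wr y Py y' t k_pos assms \<beta>1 r\<rho>
      by (intro order_trans[OF norm_coh_term_Suc] add_mono mult_mono power_mono
          mult_nonneg_nonneg add_nonneg_nonneg) auto
    also have "\<dots> = (n * r\<^sup>2 + D) * t\<^sup>2"
      by (simp add: D_def algebra_simps power2_eq_square)
    \<comment> \<open>Weakening \<open>n * r\<^sup>2\<close> to
      \<open>Suc n * \<rho>\<^sup>2\<close> makes division by \<open>Suc n\<close> give exactly the
      ratio in \<open>TS\<close>.\<close>
    also have "\<dots> \<le> (Suc n * \<rho>\<^sup>2 + D) * t\<^sup>2"
      using \<rho> assms by (intro mult_right_mono add_mono mult_mono power_mono) auto
    also have "\<dots> = Suc n * (C * T (Suc n))\<^sup>2"
      by (simp add: power_mult_distrib TS t_def field_simps)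
    finally have "(norm (?y (Suc n)))\<^sup>2 \<le> (C * T (Suc n))\<^sup>2"
      by (simp add: mult_le_cancel_left del: of_nat_Suc coh_term.simps)
    then have yS: "norm (?y (Suc n)) \<le> C * T (Suc n)"
      by (rule power2_le_imp_le) (use C T0 in auto)
    have tT: "\<rho> * t \<le> C * T (Suc n)"
      using mult_left_mono[OF T_le C, of n] by (simp add: t_def mult_ac)
    then have tT': "t \<le> C * T (Suc n) / \<rho>"
      using r\<rho> by (simp add: field_simps)
    have Py': "norm (P (?y n)) \<le> \<beta> * (C * T (Suc n) / \<rho>)"
      by (rule order_trans[OF Py mult_left_mono[OF tT']]) (use \<beta>1 in simp)
    have "norm (P (?y (Suc n))) \<le> C * T (Suc n) + R * (C * T (Suc n) / \<rho>) +
        r * (\<beta> * (C * T (Suc n) / \<rho>))"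
      using zR wr yS t Py' order_trans[OF y tT'] \<beta>1 assms
      by (intro order_trans[OF norm_a_plus_coh_term] add_mono mult_mono)
        (simp_all del: coh_term.simps)
    also have "\<dots> = (1 + R / \<rho> + \<beta> * (r / \<rho>)) * (C * T (Suc n))"
      by (simp add: algebra_simps)
    finally have "norm (P (?y (Suc n))) \<le> \<beta> * (C * T (Suc n))"
      unfolding \<beta> .
    moreover have "\<rho> * norm (?y (Suc n - 1)) \<le> C * T (Suc n)"
      using order_trans[OF mult_left_mono[OF y] tT] r\<rho> by simp
    ultimately show ?case
      using yS by blast
  qed
  have "summable (\<lambda>n. C * T n)"
    unfolding T_def using summable_majorant[of \<rho> D] \<rho> r\<rho> D by (intro summable_mult) auto
  then show thesis
    using that main by blast
qed

text \<open>By \<open>coh_term_bound\<close> the vector series converges absolutely, so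
  \<open>suminf\<close> has its genuine value and the continuous product may be taken
  termwise.\<close>

lemma sums_coherent_fun:
  assumes "cmod w < 1"
  shows "(\<lambda>n. q n \<psi> z w) sums coherent_fun \<pi> e0 \<psi> z w"
proof -
  \<comment> \<open>The maximum with 1/2 guarantees that \<open>r\<close> is positive.\<close>
  obtain r where r: "max (cmod w) (1 / 2) < r" "r < 1"
    using assms dense[of "max (cmod w) (1 / 2)" 1] by auto
  then obtain M where M: "summable M"
    "\<And>z' w' n. cmod z' \<le> cmod z \<Longrightarrow> cmod w' \<le> r \<Longrightarrow> norm (coh_term z' w' n) \<le> M n"
    using coh_term_bound[of r "cmod z"] by auto
  have "summable (coh_term (cnj z) (cnj w))"
    by (rule summable_comparison_test'[OF M(1), of 0]) (use r M(2) in auto)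
  then show ?thesis
    unfolding coherent_fun_def coherent_vec_eq q_def
    by (intro bounded_linear.sums[OF bounded_linear_cinner_left] summable_sums)
qed

lemma q_bound:
  assumes "0 < r" "r < 1" "0 \<le> R"
  obtains M where "summable M"
    "\<And>z w n. cmod z \<le> R \<Longrightarrow> cmod w \<le> r \<Longrightarrow> cmod (q n \<psi> z w) \<le> M n"
proof -
  obtain M where M: "summable M"
    "\<And>z w n. cmod z \<le> R \<Longrightarrow> cmod w \<le> r \<Longrightarrow> norm (coh_term z w n) \<le> M n"
    using coh_term_bound[OF assms] by blast
  show thesis
  proof
    show "summable (\<lambda>n. M n * norm \<psi>)"
      by (rule summable_mult2[OF M(1)])
    show "cmod (q n \<psi> z w) \<le> M n * norm \<psi>" if "cmod z \<le> R" "cmod w \<le> r" for z w n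
      unfolding q_def using that M(2)[of "cnj z" "cnj w" n]
      by (intro order_trans[OF cinner_Cauchy_Schwarz] mult_right_mono) auto
  qed
qed

lemma uniform_limit_q:
  assumes "0 < r" "r < 1" "0 \<le> R"
  shows "uniform_limit (ball 0 R \<times> ball 0 r) (\<lambda>n (z, w). \<Sum>i<n. q i \<psi> z w)
    (\<lambda>(z, w). coherent_fun \<pi> e0 \<psi> z w) sequentially"
proof -
  obtain M where M: "summable M"
    "\<And>z w n. cmod z \<le> R \<Longrightarrow> cmod w \<le> r \<Longrightarrow> cmod (q n \<psi> z w) \<le> M n"
    using q_bound[OF assms] by blast
  have "uniform_limit (ball 0 R \<times> ball 0 r) (\<lambda>n x. \<Sum>i<n. q i \<psi> (fst x) (snd x))
      (\<lambda>x. \<Sum>i. q i \<psi> (fst x) (snd x)) sequentially"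
    by (rule Weierstrass_m_test[OF _ M(1)]) (auto intro!: M(2))
  moreover have "(\<Sum>i. q i \<psi> (fst x) (snd x)) = coherent_fun \<pi> e0 \<psi> (fst x) (snd x)"
    if "x \<in> ball 0 R \<times> ball 0 r" for x
    using that assms by (intro sums_unique[symmetric] sums_coherent_fun) auto
  ultimately show ?thesis
    by (simp add: case_prod_unfold cong: uniform_limit_cong')
qed

section \<open>Derivatives of the coherent functions\<close>

text \<open>Degree by degree, \<open>A\<close> acts as the z-derivative and \<open>Km\<close> as the
  w-derivative. The product rule is applied to \<open>q_Suc\<close>; since \<open>A\<close> and
  \<open>Km\<close> commute, \<open>q_Suc\<close> also collects the result.\<close>

lemma q_has_derivative:
  "\<psi> \<in> S \<Longrightarrow> ((\<lambda>(z, w). q (Suc n) \<psi> z w) has_derivative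
     (\<lambda>(h, l). q n (A \<psi>) z w * h + q n (Km \<psi>) z w * l)) (at (z, w))"
proof (induction n arbitrary: \<psi>)
  case 0
  have "q (Suc 0) \<psi> z w = z * cinner e0 (A \<psi>) + w * cinner e0 (Km \<psi>)" for z w
    using q_Suc[OF 0, of 0 z w] by (simp add: q_0)
  then show ?case
    unfolding case_prod_unfold
    by (auto intro!: derivative_eq_intros simp: q_0 fun_eq_iff)
next
  case (Suc n)
  have eq: "q (Suc (Suc n)) \<psi> = (\<lambda>z w. (z * q (Suc n) (A \<psi>) z w + w * q (Suc n) (Km \<psi>) z w) /
      of_nat (Suc (Suc n)))"
    using q_Suc[OF Suc.prems, of "Suc n"]
    by (simp add: fun_eq_iff nonzero_eq_divide_eq mult.commute of_nat_neq_0 del: of_nat_Suc)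
  note IH = Suc.IH[unfolded case_prod_unfold]
  have "((\<lambda>x. (fst x * q (Suc n) (A \<psi>) (fst x) (snd x) +
      snd x * q (Suc n) (Km \<psi>) (fst x) (snd x)) / of_nat (Suc (Suc n))) has_derivative
     (\<lambda>x. ((z * (q n (A (A \<psi>)) z w * fst x + q n (Km (A \<psi>)) z w * snd x) +
       fst x * q (Suc n) (A \<psi>) z w) +
       (w * (q n (A (Km \<psi>)) z w * fst x + q n (Km (Km \<psi>)) z w * snd x) +
       snd x * q (Suc n) (Km \<psi>) z w)) / of_nat (Suc (Suc n)))) (at (z, w))"
    using Suc.prems
    by (auto intro!: derivative_eq_intros IH smooth_invariant simp del: of_nat_Suc)
  also have "(\<lambda>x. ((z * (q n (A (A \<psi>)) z w * fst x + q n (Km (A \<psi>)) z w * snd x) +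
       fst x * q (Suc n) (A \<psi>) z w) +
       (w * (q n (A (Km \<psi>)) z w * fst x + q n (Km (Km \<psi>)) z w * snd x) +
       snd x * q (Suc n) (Km \<psi>) z w)) / of_nat (Suc (Suc n))) =
     (\<lambda>x. (fst x * (of_nat (Suc n) * q (Suc n) (A \<psi>) z w) + fst x * q (Suc n) (A \<psi>) z w +
       snd x * (of_nat (Suc n) * q (Suc n) (Km \<psi>) z w) + snd x * q (Suc n) (Km \<psi>) z w) /
       of_nat (Suc (Suc n)))"
    using Suc.prems
    by (simp add: q_Suc q_a_K_minus smooth_invariant algebra_simps del: of_nat_Suc)
  also have "\<dots> = (\<lambda>x. q (Suc n) (A \<psi>) z w * fst x + q (Suc n) (Km \<psi>) z w * snd x)"
  proof -
    have "complex_of_nat (Suc (Suc n)) \<noteq> 0"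
      by (simp only: of_nat_eq_0_iff)
    then show ?thesis
      by (simp add: fun_eq_iff divide_simps del: of_nat_Suc) (simp add: algebra_simps)
  qed
  finally show ?case
    unfolding eq case_prod_unfold .
qed

text \<open>Termwise differentiation: on a product of balls the derivative series converges
  uniformly, by \<open>uniform_limit_q\<close> for \<open>A \<psi>\<close> and
  \<open>Km \<psi>\<close>.\<close>

lemma coherent_fun_has_derivative:
  assumes \<psi>: "\<psi> \<in> S" and w: "cmod w < 1"
  shows "((\<lambda>(u, v). coherent_fun \<pi> e0 \<psi> u v) has_derivative
     (\<lambda>(h, l). coherent_fun \<pi> e0 (A \<psi>) z w * h + coherent_fun \<pi> e0 (Km \<psi>) z w * l)) (at (z, w))"
proof -
  obtain r where r: "max (cmod w) (1 / 2) < r" "r < 1"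
    using w dense[of "max (cmod w) (1 / 2)" 1] by auto
  define R where "R = cmod z + 1"
  have R: "0 \<le> R"
    by (simp add: R_def add_nonneg_nonneg)
  let ?B = "ball 0 R \<times> ball 0 r :: (complex \<times> complex) set"
  let ?F = "\<lambda>\<psi> x. coherent_fun \<pi> e0 \<psi> (fst x) (snd x)"
  define f where "f n x = q n \<psi> (fst x) (snd x)" for n x
  \<comment> \<open>Degree 0 is constant and degree \<open>Suc m\<close> differentiates to
    \<open>q m\<close>; sums of derivatives are therefore shifted by one index.\<close>
  define f' where "f' n x h = (case n of 0 \<Rightarrow> 0 | Suc m \<Rightarrow>
     q m (A \<psi>) (fst x) (snd x) * fst h + q m (Km \<psi>) (fst x) (snd x) * snd h)"
    for n and x h :: "complex \<times> complex"
  have zw: "(z, w) \<in> ?B"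
    using r by (simp add: R_def)
  have "\<exists>g. \<forall>x\<in>?B. (\<lambda>n. f n x) sums g x \<and>
      (g has_derivative (\<lambda>h. ?F (A \<psi>) x * fst h + ?F (Km \<psi>) x * snd h)) (at x within ?B)"
  proof (rule has_derivative_series)
    show "convex ?B"
      by (intro convex_Times) auto
    show "(f n has_derivative f' n x) (at x within ?B)" for n x
    proof (cases n)
      case 0
      then show ?thesis by (simp add: f_def[abs_def] f'_def[abs_def] q_0)
    next
      case (Suc m)
      then show ?thesis
        using q_has_derivative[OF \<psi>, of m "fst x" "snd x"]
        by (auto simp: f_def[abs_def] f'_def[abs_def] case_prod_unfold
            intro: has_derivative_at_withinI)
    qed
    show "(\<lambda>n. f n (z, w)) sums ?F \<psi> (z, w)"
      using sums_coherent_fun[OF w] by (simp add: f_def)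
    show "(z, w) \<in> ?B"
      by (rule zw)
    show "\<forall>\<^sub>F n in sequentially. \<forall>x\<in>?B. \<forall>h.
        norm ((\<Sum>i<n. f' i x h) - (?F (A \<psi>) x * fst h + ?F (Km \<psi>) x * snd h)) \<le> e * norm h"
      if e: "e > 0" for e
    proof -
      have "\<forall>\<^sub>F n in sequentially. \<forall>x\<in>?B.
          norm ((\<Sum>i<n. q i \<phi> (fst x) (snd x)) - ?F \<phi> x) < e / 2" for \<phi>
        using uniform_limitD[OF uniform_limit_q[of r R \<phi>], of "e / 2"] r R e
        by (simp add: case_prod_unfold dist_norm)
      from eventually_conj[OF this[of "A \<psi>"] this[of "Km \<psi>"]]
      have "\<forall>\<^sub>F n in sequentially. \<forall>x\<in>?B.
          norm ((\<Sum>i<n. q i (A \<psi>) (fst x) (snd x)) - ?F (A \<psi>) x) < e / 2 \<and>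
          norm ((\<Sum>i<n. q i (Km \<psi>) (fst x) (snd x)) - ?F (Km \<psi>) x) < e / 2"
        by (rule eventually_mono) blast
      then have "\<forall>\<^sub>F n in sequentially. \<forall>x\<in>?B. \<forall>h.
          norm ((\<Sum>i<Suc n. f' i x h) - (?F (A \<psi>) x * fst h + ?F (Km \<psi>) x * snd h)) \<le> e * norm h"
      proof (rule eventually_mono, intro ballI allI)
        fix n x and h :: "complex \<times> complex"
        assume *: "\<forall>x\<in>?B.
          norm ((\<Sum>i<n. q i (A \<psi>) (fst x) (snd x)) - ?F (A \<psi>) x) < e / 2 \<and>
          norm ((\<Sum>i<n. q i (Km \<psi>) (fst x) (snd x)) - ?F (Km \<psi>) x) < e / 2" and x: "x \<in> ?B"
        let ?a = "(\<Sum>i<n. q i (A \<psi>) (fst x) (snd x)) - ?F (A \<psi>) x"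
        let ?b = "(\<Sum>i<n. q i (Km \<psi>) (fst x) (snd x)) - ?F (Km \<psi>) x"
        have hs: "norm (fst h) \<le> norm h" "norm (snd h) \<le> norm h"
          by (simp_all add: norm_prod_def)
        have ab: "norm ?a \<le> e / 2" "norm ?b \<le> e / 2"
          using *[rule_format, OF x] by (simp_all only: less_imp_le)
        have eq: "(\<Sum>i<Suc n. f' i x h) - (?F (A \<psi>) x * fst h + ?F (Km \<psi>) x * snd h) =
            ?a * fst h + ?b * snd h"
          unfolding sum.lessThan_Suc_shift
          by (simp add: f'_def sum.distrib flip: sum_distrib_right) (simp add: algebra_simps)
        have "norm (?a * fst h + ?b * snd h) \<le> norm ?a * norm (fst h) + norm ?b * norm (snd h)"
          by (rule order_trans[OF norm_triangle_ineq]) (simp add: norm_mult)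
        also have "\<dots> \<le> e / 2 * norm h + e / 2 * norm h"
          by (intro add_mono mult_mono ab hs) (use e in simp_all)
        finally show "norm ((\<Sum>i<Suc n. f' i x h) -
            (?F (A \<psi>) x * fst h + ?F (Km \<psi>) x * snd h)) \<le> e * norm h"
          unfolding eq by simp
      qed
      then show ?thesis
        by (subst (asm) eventually_sequentially_Suc)
    qed
  qed
  then obtain g where g: "\<And>x. x \<in> ?B \<Longrightarrow> (\<lambda>n. f n x) sums g x"
    "\<And>x. x \<in> ?B \<Longrightarrow>
      (g has_derivative (\<lambda>h. ?F (A \<psi>) x * fst h + ?F (Km \<psi>) x * snd h)) (at x within ?B)"
    by blast
  have gF: "g x = ?F \<psi> x" if "x \<in> ?B" for x
  proof -
    have "(\<lambda>n. f n x) sums ?F \<psi> x"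
      unfolding f_def using that r by (intro sums_coherent_fun) auto
    with g(1)[OF that] show ?thesis
      by (rule sums_unique2)
  qed
  have op: "open ?B"
    by (intro open_Times) auto
  have "(g has_derivative (\<lambda>h. ?F (A \<psi>) (z, w) * fst h + ?F (Km \<psi>) (z, w) * snd h)) (at (z, w))"
    using g(2)[OF zw] at_within_open[OF zw op] by simp
  then have "(?F \<psi> has_derivative
      (\<lambda>h. ?F (A \<psi>) (z, w) * fst h + ?F (Km \<psi>) (z, w) * snd h)) (at (z, w))"
    by (rule has_derivative_transform_within_open[OF _ op zw]) (rule gF)
  then show ?thesis
    by (simp add: case_prod_unfold)
qed

section \<open>Summation over the degrees for the remaining generators\<close>

lemma coherent_fun_a_plus:
  assumes "\<psi> \<in> S" "cmod w < 1"
  shows "coherent_fun \<pi> e0 (P \<psi>) z w =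
    z * coherent_fun \<pi> e0 \<psi> z w + w * coherent_fun \<pi> e0 (A \<psi>) z w"
proof (rule sums_unique2[OF sums_coherent_fun[OF assms(2)]])
  have "(\<lambda>n. q (Suc n) (P \<psi>) z w) sums
      (z * coherent_fun \<pi> e0 \<psi> z w + w * coherent_fun \<pi> e0 (A \<psi>) z w)"
    unfolding q_a_plus[OF assms(1)] by (intro sums_add sums_mult sums_coherent_fun assms)
  from sums_Suc[OF this] show "(\<lambda>n. q n (P \<psi>) z w) sums
      (z * coherent_fun \<pi> e0 \<psi> z w + w * coherent_fun \<pi> e0 (A \<psi>) z w)"
    by (simp add: q_0_a_plus assms)
qed

lemma coherent_fun_K_zero:
  assumes "\<psi> \<in> S" "cmod w < 1"
  shows "coherent_fun \<pi> e0 (K0 \<psi>) z w =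
    of_real k * coherent_fun \<pi> e0 \<psi> z w + 1 / 2 * z * coherent_fun \<pi> e0 (A \<psi>) z w +
    w * coherent_fun \<pi> e0 (Km \<psi>) z w" (is "_ = ?s")
proof (rule sums_unique2[OF sums_coherent_fun[OF assms(2)]])
  \<comment> \<open>\<open>q_K_zero\<close> starts in degree 1, so \<open>q 0 \<psi>\<close> is
    split off here and restored by \<open>q_0_K_zero\<close> at the end.\<close>
  have "(\<lambda>n. q (Suc n) \<psi> z w) sums (coherent_fun \<pi> e0 \<psi> z w - q 0 \<psi> z w)"
    using sums_coherent_fun[OF assms(2)] by (subst sums_Suc_iff) simp
  then have "(\<lambda>n. q (Suc n) (K0 \<psi>) z w) sums
      (of_real k * (coherent_fun \<pi> e0 \<psi> z w - q 0 \<psi> z w) + 1 / 2 * z * coherent_fun \<pi> e0 (A \<psi>) z w +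
        w * coherent_fun \<pi> e0 (Km \<psi>) z w)"
    unfolding q_K_zero[OF assms(1)] by (intro sums_add sums_mult sums_coherent_fun assms)
  from sums_Suc[OF this] show "(\<lambda>n. q n (K0 \<psi>) z w) sums ?s"
    by (simp add: q_0_K_zero assms algebra_simps)
qed

lemma coherent_fun_K_plus:
  assumes "\<psi> \<in> S" "cmod w < 1"
  shows "coherent_fun \<pi> e0 (Kp \<psi>) z w =
    (1 / 2 * z\<^sup>2 + 2 * of_real k * w) * coherent_fun \<pi> e0 \<psi> z w +
    z * w * coherent_fun \<pi> e0 (A \<psi>) z w + w\<^sup>2 * coherent_fun \<pi> e0 (Km \<psi>) z w" (is "_ = ?s")
proof (rule sums_unique2[OF sums_coherent_fun[OF assms(2)]])
  have "(\<lambda>n. q (Suc n) \<psi> z w) sums (coherent_fun \<pi> e0 \<psi> z w - q 0 \<psi> z w)"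
    using sums_coherent_fun[OF assms(2)] by (subst sums_Suc_iff) simp
  then have "(\<lambda>n. q (Suc (Suc n)) (Kp \<psi>) z w) sums
      (2 * of_real k * w * (coherent_fun \<pi> e0 \<psi> z w - q 0 \<psi> z w) +
        1 / 2 * z\<^sup>2 * coherent_fun \<pi> e0 \<psi> z w +
        z * w * coherent_fun \<pi> e0 (A \<psi>) z w + w\<^sup>2 * coherent_fun \<pi> e0 (Km \<psi>) z w)"
    unfolding q_K_plus[OF assms(1)] by (intro sums_add sums_mult sums_coherent_fun assms)
  \<comment> \<open>Degree 0 vanishes, and degree 1 returns the missing \<open>2 k w\<close>
    multiple of \<open>q 0 \<psi>\<close>.\<close>
  from sums_Suc[OF sums_Suc[OF this]] show "(\<lambda>n. q n (Kp \<psi>) z w) sums ?s"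
    using q_1_K_plus[OF assms(1), of z w] by (simp add: q_0_K_plus assms algebra_simps)
qed

end

section \<open>Holomorphic differential operators\<close>

lemma has_derivative_partials:
  assumes "((\<lambda>(u, v). f u v) has_derivative (\<lambda>(h, l). A * h + B * l)) (at (z, w :: complex))"
  shows "((\<lambda>u. f u w) has_field_derivative A) (at z)" "((\<lambda>v. f z v) has_field_derivative B) (at w)"
proof -
  have "((\<lambda>u. (u, w)) has_derivative (\<lambda>h. (h, 0))) (at z)"
    "((\<lambda>v. (z, v)) has_derivative (\<lambda>l. (0, l))) (at w)"
    by (auto intro!: derivative_eq_intros)
  from has_derivative_compose[OF this(1) assms] has_derivative_compose[OF this(2) assms]
  show "((\<lambda>u. f u w) has_field_derivative A) (at z)" "((\<lambda>v. f z v) has_field_derivative B) (at w)"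
    by (simp_all add: has_field_derivative_def)
qed

lemma dz_eq:
  "((\<lambda>(u, v). f u v) has_derivative (\<lambda>(h, l). A * h + B * l)) (at (z, w)) \<Longrightarrow> dz f z w = A"
  unfolding dz_def by (rule DERIV_imp_deriv) (rule has_derivative_partials)

lemma dw_eq:
  "((\<lambda>(u, v). f u v) has_derivative (\<lambda>(h, l). A * h + B * l)) (at (z, w)) \<Longrightarrow> dw f z w = B"
  unfolding dw_def by (rule DERIV_imp_deriv) (rule has_derivative_partials)

section \<open>Locality of the partial derivatives and derivatives of monomials\<close>

lemma dz_cong:
  assumes "\<And>z w. cmod w < 1 \<Longrightarrow> f z w = g z w" "cmod w < 1"
  shows "dz f z w = dz g z w"
  by (simp add: dz_def assms)

text \<open>In \<open>w\<close> the functions agree only on the open disk, so the comparison passes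
  through a neighbourhood; in \<open>z\<close> the slices agree everywhere.\<close>

lemma dw_cong:
  assumes "\<And>z w. cmod w < 1 \<Longrightarrow> f z w = g z w" "cmod w < 1"
  shows "dw f z w = dw g z w"
  unfolding dw_def
proof (rule deriv_cong_ev)
  have "\<forall>\<^sub>F v in nhds w. v \<in> ball 0 1"
    using assms(2) by (intro eventually_nhds_in_open) auto
  then show "\<forall>\<^sub>F v in nhds w. f z v = g z v"
    by (rule eventually_mono) (simp add: assms(1))
qed simp

lemma dz_dw_cong:
  assumes "\<And>z w. cmod w < 1 \<Longrightarrow> f z w = g z w" "cmod w < 1"
  shows "(dz ^^ i) ((dw ^^ j) f) z w = (dz ^^ i) ((dw ^^ j) g) z w"
proof -
  have *: "(dw ^^ j) f z w = (dw ^^ j) g z w" if "cmod w < 1" for z w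
    using that by (induction j arbitrary: z w) (auto simp: assms(1) intro!: dw_cong)
  show ?thesis
    using assms(2) by (induction i arbitrary: z w) (auto simp: * intro!: dz_cong)
qed

lemma dz_dw_product:
  assumes "g holomorphic_on UNIV" "h holomorphic_on UNIV"
  shows "(dz ^^ i) ((dw ^^ j) (\<lambda>z w. g z * h w)) = (\<lambda>z w. (deriv ^^ i) g z * (deriv ^^ j) h w)"
proof -
  have diff: "(deriv ^^ n) f field_differentiable at x" if "f holomorphic_on UNIV" for n f x
    using holomorphic_higher_deriv[OF that open_UNIV] by (simp add: holomorphic_on_def)
  have dz1: "dz (\<lambda>z w. f z * c w) = (\<lambda>z w. deriv f z * c w)"
    if "\<And>x. f field_differentiable at x" for f c
    using that by (simp add: dz_def fun_eq_iff deriv_cmult_right)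
  have dw1: "dw (\<lambda>z w. c z * f w) = (\<lambda>z w. c z * deriv f w)"
    if "\<And>x. f field_differentiable at x" for f c
    using that by (simp add: dw_def fun_eq_iff deriv_cmult)
  have *: "(dw ^^ j) (\<lambda>z w. g z * h w) = (\<lambda>z w. g z * (deriv ^^ j) h w)"
    by (induction j) (simp_all add: dw1 diff assms)
  show ?thesis
    by (induction i) (simp_all add: * dz1 diff assms)
qed

text \<open>For \<open>m < n\<close> a positive power of 0 remains; for \<open>m > n\<close> the
  Pochhammer symbol starts at 0.\<close>

lemma higher_deriv_power_at_centre:
  "(deriv ^^ m) (\<lambda>x. (x - a) ^ n) a = (if m = n then fact n else 0 :: complex)"
  by (cases m n rule: linorder_cases)
    (simp_all add: higher_deriv_power pochhammer_0_left pochhammer_fact)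

lemma dz_dw_monomial:
  "(dz ^^ i) ((dw ^^ j) (\<lambda>z w. (z - a) ^ m * (w - b) ^ n)) a b =
     (if i = m \<and> j = n then fact m * fact n else 0)"
  by (subst dz_dw_product)
    (auto intro!: holomorphic_intros simp: higher_deriv_power_at_centre)

text \<open>The coefficient of \<open>\<partial>\<^sub>z\<^sup>i \<partial>\<^sub>w\<^sup>j\<close> in the asserted operator of a generator.\<close>

fun gen_coeff :: "real \<Rightarrow> jacobi_gen \<Rightarrow> nat \<times> nat \<Rightarrow> complex \<Rightarrow> complex \<Rightarrow> complex" where
  "gen_coeff k Gen_a ij z w = (if ij = (1, 0) then 1 else 0)"
| "gen_coeff k Gen_a_plus ij z w =
    (if ij = (0, 0) then z else if ij = (1, 0) then w else 0)"
| "gen_coeff k Gen_K_minus ij z w = (if ij = (0, 1) then 1 else 0)"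
| "gen_coeff k Gen_K_zero ij z w =
    (if ij = (0, 0) then of_real k else if ij = (1, 0) then 1 / 2 * z
     else if ij = (0, 1) then w else 0)"
| "gen_coeff k Gen_K_plus ij z w =
    (if ij = (0, 0) then 1 / 2 * z\<^sup>2 + 2 * of_real k * w else if ij = (1, 0) then z * w
     else if ij = (0, 1) then w\<^sup>2 else 0)"

definition gen_diff_op ::
  "real \<Rightarrow> jacobi_gen \<Rightarrow> (complex \<Rightarrow> complex \<Rightarrow> complex) \<Rightarrow> complex \<Rightarrow> complex \<Rightarrow> complex" where
  "gen_diff_op k X f z w = gen_coeff k X (0, 0) z w * f z w +
     gen_coeff k X (1, 0) z w * dz f z w + gen_coeff k X (0, 1) z w * dw f z w"

lemma gen_coeff_eq_0: "ij \<notin> {(0, 0), (1, 0), (0, 1)} \<Longrightarrow> gen_coeff k X ij z w = 0"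
  by (cases X) auto

lemma gen_diff_op_eq_sum:
  "gen_diff_op k X f z w =
     (\<Sum>(i, j)\<in>{(0, 0), (1, 0), (0, 1)}. gen_coeff k X (i, j) z w * (dz ^^ i) ((dw ^^ j) f) z w)"
  by (simp add: gen_diff_op_def)

lemma gen_diff_op_cong:
  assumes "\<And>z w. cmod w < 1 \<Longrightarrow> f z w = g z w" "cmod w < 1"
  shows "gen_diff_op k X f z w = gen_diff_op k X g z w"
  unfolding gen_diff_op_def using dz_cong[OF assms] dw_cong[OF assms] assms by simp

text \<open>Keeps the generator a variable in the main argument instead of running five parallel
  formulas.\<close>

lemma all_gen_diff_op_iff:
  "(\<forall>X. D X f z w = gen_diff_op k X f z w) \<longleftrightarrow>
     D Gen_a f z w = dz f z w \<and>
     D Gen_a_plus f z w = z * f z w + w * dz f z w \<and>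
     D Gen_K_minus f z w = dw f z w \<and>
     D Gen_K_zero f z w = of_real k * f z w + 1 / 2 * z * dz f z w + w * dw f z w \<and>
     D Gen_K_plus f z w =
       (1 / 2 * z\<^sup>2 + 2 * of_real k * w) * f z w + z * w * dz f z w + w\<^sup>2 * dw f z w"
  (is "?l \<longleftrightarrow> ?r")
proof
  show "?l \<Longrightarrow> ?r"
    by (auto simp: gen_diff_op_def)
  assume ?r
  then have "D X f z w = gen_diff_op k X f z w" for X
    by (cases X) (auto simp: gen_diff_op_def)
  then show ?l ..
qed

lemma holo_gen_coeff: "holo_CxD (gen_coeff k X ij)"
proof -
  consider "ij = (0, 0)" | "ij = (1, 0)" | "ij = (0, 1)" | "ij \<notin> {(0, 0), (1, 0), (0, 1)}"
    by auto
  then have "\<exists>A B. \<forall>z w. ((\<lambda>x. gen_coeff k X ij (fst x) (snd x)) has_derivative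
      (\<lambda>x. A z w * fst x + B z w * snd x)) (at (z, w))"
  proof cases
    case 1
    show ?thesis
    proof (rule exI[of _ "\<lambda>z w. case X of Gen_a_plus \<Rightarrow> 1 | Gen_K_plus \<Rightarrow> z | _ \<Rightarrow> 0"],
        rule exI[of _ "\<lambda>z w. case X of Gen_K_plus \<Rightarrow> 2 * of_real k | _ \<Rightarrow> 0"], intro allI)
    qed (use 1 in \<open>cases X; auto intro!: derivative_eq_intros\<close>)
  next
    case 2
    show ?thesis
    proof (rule exI[of _ "\<lambda>z w. case X of Gen_K_zero \<Rightarrow> 1 / 2 | Gen_K_plus \<Rightarrow> w | _ \<Rightarrow> 0"],
        rule exI[of _ "\<lambda>z w. case X of Gen_a_plus \<Rightarrow> 1 | Gen_K_plus \<Rightarrow> z | _ \<Rightarrow> 0"], intro allI)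
    qed (use 2 in \<open>cases X; auto intro!: derivative_eq_intros simp: fun_eq_iff\<close>)
  next
    case 3
    show ?thesis
    proof (rule exI[of _ "\<lambda>z w. 0"],
        rule exI[of _ "\<lambda>z w. case X of Gen_K_zero \<Rightarrow> 1 | Gen_K_plus \<Rightarrow> 2 * w | _ \<Rightarrow> 0"], intro allI)
    qed (use 3 in \<open>cases X; auto intro!: derivative_eq_intros simp: fun_eq_iff\<close>)
  next
    case 4
    then show ?thesis
      by (intro exI[of _ "\<lambda>z w. 0"]) (simp add: gen_coeff_eq_0)
  qed
  then show ?thesis
    unfolding holo_CxD_def case_prod_unfold by blast
qed

lemma diff_op_gen_diff_op:
  assumes "\<And>f z w. holo_CxD f \<Longrightarrow> cmod w < 1 \<Longrightarrow> D f z w = gen_diff_op k X f z w"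
  shows "diff_op D"
  unfolding diff_op_def
proof (intro exI conjI allI impI)
  show "holo_CxD (gen_coeff k X (i, j))" for i j
    by (rule holo_gen_coeff)
  \<comment> \<open>The order bound is 1 in each variable; the surplus pair \<open>(1, 1)\<close>
    has coefficient 0.\<close>
  show "D f z w =
      (\<Sum>i\<le>1. \<Sum>j\<le>1. gen_coeff k X (i, j) z w * (dz ^^ i) ((dw ^^ j) f) z w)"
    if "holo_CxD f" "cmod w < 1" for f z w
    using assms[OF that] gen_coeff_eq_0[of "(1, 1)" k X z w] by (simp add: gen_diff_op_def)
qed

text \<open>Shifted monomials detect the coefficients of a differential operator one by one.\<close>

lemma gen_diff_op_eqI:
  assumes "\<And>f. holo_CxD f \<Longrightarrow>
      D f = (\<Sum>i\<le>N::nat. \<Sum>j\<le>N. c i j * (dz ^^ i) ((dw ^^ j) f) z w)"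
    and w: "cmod w < 1"
    and mono: "\<And>m n. \<exists>f. holo_CxD f \<and> (\<forall>u v. cmod v < 1 \<longrightarrow> f u v = (u - z) ^ m * (v - w) ^ n) \<and>
      D f = gen_diff_op k X f z w"
    and f: "holo_CxD f"
  shows "D f = gen_diff_op k X f z w"
proof -
  have D: "D g = (\<Sum>(i, j)\<in>{..N} \<times> {..N}. c i j * (dz ^^ i) ((dw ^^ j) g) z w)"
    if "holo_CxD g" for g
    using assms(1)[OF that] by (simp add: sum.cartesian_product)
  \<comment> \<open>On a monomial centred at \<open>(z, w)\<close> both operators retain a single
    term, \<open>fact m * fact n\<close> times their coefficient. The conditional extends
    \<open>c\<close> by 0 beyond the order \<open>N\<close>.\<close>
  have coeff: "(if m \<le> N \<and> n \<le> N then c m n else 0) = gen_coeff k X (m, n) z w" for m n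
  proof -
    let ?p = "\<lambda>u v. (u - z) ^ m * (v - w) ^ n"
    obtain g where g: "holo_CxD g" "\<And>u v. cmod v < 1 \<Longrightarrow> g u v = ?p u v"
      "D g = gen_diff_op k X g z w"
      using mono[of m n] by blast
    have d: "(dz ^^ i) ((dw ^^ j) g) z w = (if i = m \<and> j = n then fact m * fact n else 0)" for i j
      using dz_dw_cong[of g ?p, OF g(2) w] dz_dw_monomial by simp
    have "D g = (\<Sum>x\<in>{..N} \<times> {..N}.
        if x = (m, n) then c m n * (fact m * fact n) else 0)"
      unfolding D[OF g(1)] d by (rule sum.cong) (auto split: if_splits)
    also have "\<dots> = (if m \<le> N \<and> n \<le> N then c m n else 0) * (fact m * fact n)"
      by simp
    finally have 1: "D g = (if m \<le> N \<and> n \<le> N then c m n else 0) * (fact m * fact n)" .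
    have "gen_diff_op k X g z w = (\<Sum>x\<in>{(0, 0), (1, 0), (0, 1)}.
        if x = (m, n) then gen_coeff k X (m, n) z w * (fact m * fact n) else 0)"
      unfolding gen_diff_op_eq_sum d by (rule sum.cong) (auto split: if_splits)
    also have "\<dots> = (if (m, n) \<in> {(0, 0), (1, 0), (0, 1)} then gen_coeff k X (m, n) z w else 0) *
        (fact m * fact n)"
      by (subst sum.delta) auto
    also have "\<dots> = gen_coeff k X (m, n) z w * (fact m * fact n)"
      using gen_coeff_eq_0[of "(m, n)" k X z w] by auto
    finally show ?thesis
      using 1 g(3) by simp
  qed
  show ?thesis
    unfolding D[OF f] gen_diff_op_eq_sum
  \<comment> \<open>The two finite index sets need not be nested; by \<open>coeff\<close> the
    coefficients vanish off their intersection.\<close>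
  proof (rule sum.mono_neutral_cong)
    show "(case x of (i, j) \<Rightarrow> gen_coeff k X (i, j) z w * (dz ^^ i) ((dw ^^ j) f) z w) = 0"
      if "x \<in> {(0, 0), (1, 0), (0, 1)} - {..N} \<times> {..N}" for x
      using that coeff[of "fst x" "snd x"] by (auto split: if_splits)
    show "(case x of (i, j) \<Rightarrow> c i j * (dz ^^ i) ((dw ^^ j) f) z w) = 0"
      if "x \<in> {..N} \<times> {..N} - {(0, 0), (1, 0), (0, 1)}" for x
      using that coeff[of "fst x" "snd x"] gen_coeff_eq_0[of x k X z w] by auto
    show "(case x of (i, j) \<Rightarrow> c i j * (dz ^^ i) ((dw ^^ j) f) z w) =
        (case x of (i, j) \<Rightarrow> gen_coeff k X (i, j) z w * (dz ^^ i) ((dw ^^ j) f) z w)"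
      if "x \<in> {..N} \<times> {..N} \<inter> {(0, 0), (1, 0), (0, 1)}" for x
      using that coeff[of "fst x" "snd x"] by (auto split: if_splits)
  qed auto
qed

section \<open>Polynomials as coherent functions\<close>

context jacobi_lowest_weight_rep
begin

lemma holo_coherent_fun: "\<psi> \<in> S \<Longrightarrow> holo_CxD (coherent_fun \<pi> e0 \<psi>)"
  unfolding holo_CxD_def using coherent_fun_has_derivative by blast

lemma coherent_fun_gen_op:
  assumes "\<psi> \<in> S" "cmod w < 1"
  shows "coherent_fun \<pi> e0 (gen_op \<pi> X \<psi>) z w = gen_diff_op k X (coherent_fun \<pi> e0 \<psi>) z w"
  using assms
  by (cases X)
    (simp_all add: gen_diff_op_def dz_eq[OF coherent_fun_has_derivative[OF assms]]
      dw_eq[OF coherent_fun_has_derivative[OF assms]]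
      coherent_fun_a_plus coherent_fun_K_zero coherent_fun_K_plus)

text \<open>Agreement is asked on the domain alone, as \<open>coherent_vec\<close> is not controlled
  for \<open>cmod w \<ge> 1\<close>.\<close>

definition attained :: "(complex \<Rightarrow> complex \<Rightarrow> complex) \<Rightarrow> bool" where
  "attained p \<longleftrightarrow> (\<exists>\<psi>\<in>S. \<forall>z w. cmod w < 1 \<longrightarrow> coherent_fun \<pi> e0 \<psi> z w = p z w)"

lemma attained_add: "attained p \<Longrightarrow> attained r \<Longrightarrow> attained (\<lambda>z w. p z w + r z w)"
  unfolding attained_def coherent_fun_def
  by (metis cinner_add_right smooth_add)

lemma attained_scale: "attained p \<Longrightarrow> attained (\<lambda>z w. c * p z w)"
  unfolding attained_def coherent_fun_def
  by (metis cinner_scaleC_right smooth_scaleC)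

text \<open>By \<open>coherent_fun_gen_op\<close>, applying the generator to \<open>\<psi>\<close>
  realises the operator on the function.\<close>

lemma attained_gen_diff_op: "attained p \<Longrightarrow> attained (gen_diff_op k X p)"
  unfolding attained_def
  by (metis coherent_fun_gen_op gen_diff_op_cong smooth_invariant)

text \<open>\<open>A\<close> and \<open>Km\<close> kill \<open>e0\<close>, so the function of
  \<open>e0\<close> is its degree 0 part, the nonzero constant
  \<open>(norm e0)\<^sup>2\<close>.\<close>

lemma attained_one: "attained (\<lambda>z w. 1)"
proof -
  have "coherent_fun \<pi> e0 e0 z w = of_real ((norm e0)\<^sup>2)" if "cmod w < 1" for z w
  proof (rule sums_unique2[OF sums_coherent_fun[OF that]])
    have "q (Suc n) e0 z w = 0" for n
      using q_Suc[OF e0_smooth, of n z w]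
      by (simp add: a_e0 K_minus_e0 q_def del: of_nat_Suc coh_term.simps)
    then show "(\<lambda>n. q n e0 z w) sums of_real ((norm e0)\<^sup>2)"
      using sums_Suc[of "\<lambda>n. q n e0 z w" 0] by (simp add: q_0 cinner_self)
  qed
  then have "attained (\<lambda>z w. of_real ((norm e0)\<^sup>2))"
    unfolding attained_def using e0_smooth by blast
  from attained_scale[OF this, of "1 / of_real ((norm e0)\<^sup>2)"] show ?thesis
    using e0_nonzero by simp
qed

lemma dz_power: "dz (\<lambda>z w. z ^ i * w ^ j) z w = of_nat i * z ^ (i - 1) * w ^ j"
  unfolding dz_def by (rule DERIV_imp_deriv) (auto intro!: derivative_eq_intros)

lemma dw_power: "dw (\<lambda>z w. z ^ i * w ^ j) z w = z ^ i * (of_nat j * w ^ (j - 1))"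
  unfolding dw_def by (rule DERIV_imp_deriv) (auto intro!: derivative_eq_intros)

lemma attained_a_plus_power:
  "attained (\<lambda>z w. z ^ i * w ^ j) \<Longrightarrow>
    attained (\<lambda>z w. z ^ Suc i * w ^ j + of_nat i * (z ^ (i - 1) * w ^ Suc j))"
  using attained_gen_diff_op[of "\<lambda>z w. z ^ i * w ^ j" Gen_a_plus]
  by (simp add: gen_diff_op_def[abs_def] dz_power mult_ac)

text \<open>\<open>K\<^sub>+ - (a\<^sup>+)\<^sup>2 / 2\<close> commutes with the Heisenberg algebra; its differential operator maps
  \<open>w\<^sup>j\<close> to \<open>(2 k - 1 / 2 + j) w\<^sup>j\<^sup>+\<^sup>1\<close>.\<close>

lemma attained_power_w: "attained (\<lambda>z w. w ^ j)"
proof (induction j)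
  case 0
  then show ?case using attained_one by simp
next
  case (Suc j)
  have 1: "attained (\<lambda>z w. z ^ 1 * w ^ j)"
    using attained_a_plus_power[of 0 j] Suc by simp
  have 2: "attained (\<lambda>z w. z\<^sup>2 * w ^ j + w ^ Suc j)"
    using attained_a_plus_power[OF 1] by (simp add: power2_eq_square mult.assoc)
  have "attained (gen_diff_op k Gen_K_plus (\<lambda>z w. z ^ 0 * w ^ j))"
    using Suc by (intro attained_gen_diff_op) simp
  also have "gen_diff_op k Gen_K_plus (\<lambda>z w. z ^ 0 * w ^ j) =
      (\<lambda>z w. 1 / 2 * (z\<^sup>2 * w ^ j) + (2 * of_real k + of_nat j) * w ^ Suc j)"
    unfolding gen_diff_op_def[abs_def] dz_power dw_power
    by (cases j) (simp_all add: fun_eq_iff algebra_simps power2_eq_square)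
  finally have "attained (\<lambda>z w. 1 / (2 * of_real k + of_nat j - 1 / 2) *
      ((1 / 2 * (z\<^sup>2 * w ^ j) + (2 * of_real k + of_nat j) * w ^ Suc j) +
       (- 1 / 2) * (z\<^sup>2 * w ^ j + w ^ Suc j)))"
    by (rule attained_scale[OF attained_add[OF _ attained_scale[OF 2]]])
  also have "(\<lambda>z w. 1 / (2 * of_real k + of_nat j - 1 / 2) *
      ((1 / 2 * (z\<^sup>2 * w ^ j) + (2 * of_real k + of_nat j) * w ^ Suc j) +
       (- 1 / 2) * (z\<^sup>2 * w ^ j + w ^ Suc j))) = (\<lambda>z w :: complex. w ^ Suc j)"
  proof (intro ext)
    fix z w :: complex
    define c where "c = 2 * complex_of_real k + of_nat j - 1 / 2"
    \<comment> \<open>By \<open>two_k\<close> the divisor has real part at least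
      \<open>3 / 2\<close>.\<close>
    have "Re c > 0"
      using two_k by (auto simp: c_def)
    then have "c \<noteq> 0"
      by auto
    moreover have "(1 / 2 * (z\<^sup>2 * w ^ j) + (2 * of_real k + of_nat j) * w ^ Suc j) +
       (- 1 / 2) * (z\<^sup>2 * w ^ j + w ^ Suc j) = c * w ^ Suc j"
      by (simp add: c_def algebra_simps)
    ultimately show "1 / (2 * of_real k + of_nat j - 1 / 2) *
      ((1 / 2 * (z\<^sup>2 * w ^ j) + (2 * of_real k + of_nat j) * w ^ Suc j) +
       (- 1 / 2) * (z\<^sup>2 * w ^ j + w ^ Suc j)) = w ^ Suc j"
      unfolding c_def[symmetric] by simp
  qed
  finally show ?case .
qed

text \<open>\<open>a\<^sup>+\<close> raises the power of \<open>z\<close> up to a term with smaller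
  power of \<open>z\<close> and larger power of \<open>w\<close>; strong induction on
  \<open>i\<close>, for all \<open>j\<close>, supplies that term for subtraction.\<close>

lemma attained_power: "attained (\<lambda>z w. z ^ i * w ^ j)"
proof (induction i arbitrary: j rule: less_induct)
  case (less i)
  show ?case
  proof (cases i)
    case 0
    then show ?thesis using attained_power_w by simp
  next
    case (Suc n)
    have "attained (\<lambda>z w. z ^ Suc n * w ^ j + of_nat n * (z ^ (n - 1) * w ^ Suc j))"
      by (intro attained_a_plus_power less) (simp add: Suc)
    moreover have "attained (\<lambda>z w. z ^ (n - 1) * w ^ Suc j)"
      by (rule less) (simp add: Suc)
    ultimately have "attained (\<lambda>z w. (z ^ Suc n * w ^ j + of_nat n * (z ^ (n - 1) * w ^ Suc j)) +
        (- of_nat n) * (z ^ (n - 1) * w ^ Suc j))"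
      by (rule attained_add[OF _ attained_scale])
    then show ?thesis
      by (simp add: Suc)
  qed
qed

text \<open>Expanding one factor \<open>z - a\<close> produces a stray factor \<open>z\<close>,
  which the free exponent \<open>l\<close> absorbs.\<close>

lemma attained_shifted_power_z: "attained (\<lambda>z w. z ^ l * w ^ m * (z - a) ^ i)"
proof (induction i arbitrary: l)
  case 0
  then show ?case using attained_power by simp
next
  case (Suc i)
  have "attained (\<lambda>z w. z ^ Suc l * w ^ m * (z - a) ^ i + (- a) * (z ^ l * w ^ m * (z - a) ^ i))"
    by (intro attained_add attained_scale Suc)
  then show ?case
    by (simp add: algebra_simps)
qed

lemma attained_shifted_power: "attained (\<lambda>z w. w ^ m * ((z - a) ^ i * (w - b) ^ j))"
proof (induction j arbitrary: m)
  case 0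
  then show ?case using attained_shifted_power_z[of 0 m a i] by simp
next
  case (Suc j)
  have "attained (\<lambda>z w. w ^ Suc m * ((z - a) ^ i * (w - b) ^ j) +
      (- b) * (w ^ m * ((z - a) ^ i * (w - b) ^ j)))"
    by (intro attained_add attained_scale Suc)
  then show ?case
    by (simp add: algebra_simps)
qed

end

theorem lemma1:
  fixes \<pi> :: "jacobi \<Rightarrow> 'h::complex_hilbert \<Rightarrow> 'h" and e0 :: 'h and k :: real
    and \<DD> :: "jacobi_gen \<Rightarrow> (complex \<Rightarrow> complex \<Rightarrow> complex) \<Rightarrow> complex \<Rightarrow> complex \<Rightarrow> complex"
  assumes "jacobi_lowest_weight_rep \<pi> e0 k"
  shows "(\<forall>\<psi>\<in>smooth_vectors \<pi>. holo_CxD (coherent_fun \<pi> e0 \<psi>)) \<and>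
      (((\<forall>X. diff_op (\<DD> X)) \<and>
          (\<forall>X. \<forall>\<psi>\<in>smooth_vectors \<pi>. \<forall>z w. cmod w < 1 \<longrightarrow>
             \<DD> X (coherent_fun \<pi> e0 \<psi>) z w =
               cinner (coherent_vec \<pi> e0 (cnj z) (cnj w)) (gen_op \<pi> X \<psi>)))
      \<longleftrightarrow>
         (\<forall>f z w. holo_CxD f \<longrightarrow> cmod w < 1 \<longrightarrow>
             \<DD> Gen_a f z w = dz f z w \<and>
             \<DD> Gen_a_plus f z w = z * f z w + w * dz f z w \<and>
             \<DD> Gen_K_minus f z w = dw f z w \<and>
             \<DD> Gen_K_zero f z w = of_real k * f z w + 1 / 2 * z * dz f z w + w * dw f z w \<and>
             \<DD> Gen_K_plus f z w =
               (1 / 2 * z\<^sup>2 + 2 * of_real k * w) * f z w + z * w * dz f z w + w\<^sup>2 * dw f z w))"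
proof -
  interpret jacobi_lowest_weight_rep \<pi> e0 k
    by (rule assms)
  show ?thesis
    unfolding all_gen_diff_op_iff[symmetric] coherent_fun_def[of \<pi> e0 "gen_op \<pi> _ _", symmetric]
  proof (intro conjI ballI iffI allI impI)
    show "holo_CxD (coherent_fun \<pi> e0 \<psi>)" if "\<psi> \<in> S" for \<psi>
      by (rule holo_coherent_fun[OF that])
  next
    fix f z w X
    assume *: "(\<forall>X. diff_op (\<DD> X)) \<and> (\<forall>X. \<forall>\<psi>\<in>S. \<forall>z w. cmod w < 1 \<longrightarrow>
        \<DD> X (coherent_fun \<pi> e0 \<psi>) z w = coherent_fun \<pi> e0 (gen_op \<pi> X \<psi>) z w)"
      and f: "holo_CxD f" and w: "cmod w < 1"
    \<comment> \<open>At the fixed point \<open>(z, w)\<close> the coefficient functions of the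
      operator become numbers.\<close>
    obtain N c where D: "\<And>f. holo_CxD f \<Longrightarrow> \<DD> X f z w =
        (\<Sum>i\<le>N::nat. \<Sum>j\<le>N. c i j z w * (dz ^^ i) ((dw ^^ j) f) z w)"
      using * w unfolding diff_op_def by meson
    show "\<DD> X f z w = gen_diff_op k X f z w"
    proof (rule gen_diff_op_eqI[where D = "\<lambda>f. \<DD> X f z w", OF D w _ f])
      fix m n
      \<comment> \<open>Monomials centred at the point are coherent functions, and on these the
        assumed relation prescribes \<open>\<DD> X\<close>.\<close>
      obtain \<psi> where \<psi>: "\<psi> \<in> S"
        "\<And>u v. cmod v < 1 \<Longrightarrow> coherent_fun \<pi> e0 \<psi> u v = (u - z) ^ m * (v - w) ^ n"
        using attained_shifted_power[of 0 z m w n] unfolding attained_def by auto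
      then show "\<exists>f. holo_CxD f \<and>
          (\<forall>u v. cmod v < 1 \<longrightarrow> f u v = (u - z) ^ m * (v - w) ^ n) \<and>
          \<DD> X f z w = gen_diff_op k X f z w"
        using * w by (intro exI[of _ "coherent_fun \<pi> e0 \<psi>"])
          (simp add: holo_coherent_fun coherent_fun_gen_op)
    qed
  next
    fix X
    assume *: "\<forall>f z w. holo_CxD f \<longrightarrow> cmod w < 1 \<longrightarrow>
      (\<forall>X. \<DD> X f z w = gen_diff_op k X f z w)"
    then show "diff_op (\<DD> X)"
      by (intro diff_op_gen_diff_op) blast
    show "\<DD> X (coherent_fun \<pi> e0 \<psi>) z w = coherent_fun \<pi> e0 (gen_op \<pi> X \<psi>) z w"
      if "\<psi> \<in> S" "cmod w < 1" for \<psi> z w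
      using * that by (simp add: holo_coherent_fun coherent_fun_gen_op)
  qed
qed

end
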